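(* Let $(Y,X_1,\dots,X_d)$ be a random vector in $\mathbb R^{1+d}$ with continuous marginal cdfs $F_Y$ and $F_{X_i}$, $i=1,\dots,d$, respectively, and with Archimedean copula $$C(y,x)=\psi\big(\psi^{-1}(y)+\psi^{-1}(x_1)+\cdots+\psi^{-1}(x_d)\big),\quad y\in(0,1),\ x=(x_i)_{i=1}^d\in(0,1)^d,$$ where the generator $\psi:(0,\infty)\to(0,1)$ is completely monotone, i.e. $\psi(u)=\int_0^\infty e^{-ux}\mu(dx)$, $u>0$, for a unique Borel measure $\mu$ on $[0,\infty)$. Then, for all $\tau\in(0,1)$ and $y_0\in\mathbb R$, the events $$\Big\{\psi\Big(\psi^{-1}(F_{X_1}(X_1))+\cdots+\psi^{-1}(F_{X_d}(X_d))\Big)>\tau\Big\}$$ are optimal predictors of the events $\{Y>y_0\}$ in terms of $X=(X_1,\dots,X_d)$.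
   Context: The copula of $(Y,X)$ is $C(y,x)=\mathbb P[F_Y(Y)\le y,\ F_{X_i}(X_i)\le x_i,\ i=1,\dots,d]$. The generator $\psi$ is a decreasing function; since $C$ is a copula, the measure $\mu$ does not charge $\{0\}$. For a Borel function $h:\mathbb R^d\to\mathbb R$ and $h_0\in\mathbb R$, the predictor $\{h(X)>h_0\}$ of $\{Y>y_0\}$ is $q$-calibrated, $q\in(0,1)$, if $\mathbb P[h(X)>h_0]=1-q$. A $q$-calibrated predictor $\{h(X)>h_0\}$ of $\{Y>y_0\}$ is optimal if $\mathbb P[Y>y_0\mid h(X)>h_0]\ge\mathbb P[Y>y_0\mid g(X)>g_0]$ for all other $q$-calibrated predictors $\{g(X)>g_0\}$ ($g$ Borel, $g_0\in\mathbb R$). Here optimality is at the predictor's own calibration level. *)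

theory Defs
  imports "HOL-Probability.Probability"
begin

definition copula :: "'a measure \<Rightarrow> ('a \<Rightarrow> real) \<Rightarrow> ('a \<Rightarrow> real ^ 'd) \<Rightarrow> real \<Rightarrow> real ^ 'd \<Rightarrow> real" where
  "copula M Y X y x =
     \<P>(\<omega> in M. cdf (distr M borel Y) (Y \<omega>) \<le> y \<and>
               (\<forall>i. cdf (distr M borel (\<lambda>\<omega>. X \<omega> $ i)) (X \<omega> $ i) \<le> x $ i))"

text \<open>
  Complete monotonicity is the Laplace representation by a Borel measure on the half-line.
  Only the values of \<open>\<psi>\<close> on the positive reals matter. Uniqueness of \<open>\<mu>\<close> is automatic and
  therefore not demanded; nor is \<open>\<mu> {0} = 0\<close>, which follows once \<open>\<psi>\<close> generates a copula.
\<close>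
definition cm_generator :: "(real \<Rightarrow> real) \<Rightarrow> bool" where
  "cm_generator \<psi> \<longleftrightarrow>
     \<psi> \<in> {0<..} \<rightarrow> {0<..<1} \<and>
     (\<exists>\<mu> :: real measure. sets \<mu> = sets (restrict_space borel {0..}) \<and>
        (\<forall>u>0. has_bochner_integral \<mu> (\<lambda>x. exp (- u * x)) (\<psi> u)))"

text \<open>
  The usual continuous extensions \<open>\<psi>(0) = 1\<close>, \<open>\<psi>(\<infinity>) = 0\<close> and correspondingly
  \<open>\<psi>\<^sup>-\<^sup>1(1) = 0\<close>, \<open>\<psi>\<^sup>-\<^sup>1(0) = \<infinity>\<close>. They are needed because the marginal cdfs may take the values
  0 and 1 (with probability zero), where the score below must still be defined and Borel.
  Surjectivity of \<open>\<psi>\<close> onto the open unit interval is not assumed: it follows when the formula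
  \<open>arch_copula \<psi> y x\<close> agrees with a copula for all arguments in the open unit cube.
\<close>
definition gen :: "(real \<Rightarrow> real) \<Rightarrow> ennreal \<Rightarrow> real" where
  "gen \<psi> u = (if u = 0 then 1 else if u = \<infinity> then 0 else \<psi> (enn2real u))"

definition gen_inv :: "(real \<Rightarrow> real) \<Rightarrow> real \<Rightarrow> ennreal" where
  "gen_inv \<psi> t =
     (if t \<le> 0 then \<infinity> else if t \<ge> 1 then 0 else ennreal (inv_into {0<..} \<psi> t))"

definition arch_copula :: "(real \<Rightarrow> real) \<Rightarrow> real \<Rightarrow> real ^ 'd \<Rightarrow> real" where
  "arch_copula \<psi> y x = gen \<psi> (gen_inv \<psi> y + (\<Sum>i\<in>UNIV. gen_inv \<psi> (x $ i)))"

definition arch_score ::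
    "'a measure \<Rightarrow> ('a \<Rightarrow> real ^ 'd) \<Rightarrow> (real \<Rightarrow> real) \<Rightarrow> real ^ 'd \<Rightarrow> real" where
  "arch_score M X \<psi> x =
     gen \<psi> (\<Sum>i\<in>UNIV. gen_inv \<psi> (cdf (distr M borel (\<lambda>\<omega>. X \<omega> $ i)) (x $ i)))"

definition calibrated ::
    "'a measure \<Rightarrow> ('a \<Rightarrow> real ^ 'd) \<Rightarrow> real \<Rightarrow> (real ^ 'd \<Rightarrow> real) \<Rightarrow> real \<Rightarrow> bool" where
  "calibrated M X q h h0 \<longleftrightarrow>
     h \<in> borel_measurable borel \<and> \<P>(\<omega> in M. h (X \<omega>) > h0) = 1 - q"

text \<open>The level \<open>q\<close> is determined by the predictor, so this is optimality at its own level.\<close>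
definition optimal_predictor ::
    "'a measure \<Rightarrow> ('a \<Rightarrow> real) \<Rightarrow> ('a \<Rightarrow> real ^ 'd) \<Rightarrow> real \<Rightarrow> (real ^ 'd \<Rightarrow> real) \<Rightarrow> real \<Rightarrow> bool" where
  "optimal_predictor M Y X y0 h h0 \<longleftrightarrow>
     (\<exists>q\<in>{0<..<1}. calibrated M X q h h0 \<and>
        (\<forall>g g0. calibrated M X q g g0 \<longrightarrow>
           \<P>(\<omega> in M. Y \<omega> > y0 \<bar> h (X \<omega>) > h0) \<ge> \<P>(\<omega> in M. Y \<omega> > y0 \<bar> g (X \<omega>) > g0)))"

end

theory Submission
  imports Defs
begin

text \<open>
  Put \<open>E\<^sub>i = \<psi>\<^sup>-\<^sup>1(F\<^sub>i(X\<^sub>i))\<close>, \<open>S = E\<^sub>1 + \<dots> + E\<^sub>d\<close>, \<open>c = F\<^sub>Y(y\<^sub>0)\<close> and \<open>t = \<psi>\<^sup>-\<^sup>1(c)\<close>. The copula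
  formula says that the upper orthant probabilities of \<open>E\<close>, on the whole space and on \<open>{Y \<le> y\<^sub>0}\<close>,
  are \<open>\<psi>(\<Sum> a\<^sub>i)\<close> and \<open>\<psi>(t + \<Sum> a\<^sub>i)\<close>. Hence \<open>E\<close> has in the two cases the Lebesgue densities
  \<open>D(S)\<close> and \<open>D(t + S)\<close> on the positive orthant, with \<open>D(s) = \<integral> z\<^sup>d exp(- s z) d\<mu>\<close>. The ratio
  \<open>D(t + s) / D(s)\<close>, which is the conditional probability of \<open>Y \<le> y\<^sub>0\<close> given \<open>S = s\<close>, is
  nondecreasing in \<open>s\<close>, so among all events of equal probability that depend on \<open>X\<close> the sublevel
  set \<open>{S < \<psi>\<^sup>-\<^sup>1(\<tau>)} = {\<psi>(S) > \<tau>}\<close> carries the least mass of \<open>{Y \<le> y\<^sub>0}\<close>, by the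
  Neyman--Pearson argument.
\<close>

subsection \<open>Upper orthants and continuous distribution functions\<close>

text \<open>Open orthants with arbitrary corners form an intersection-stable generator of the Borel
  sets. As both measures live on the positive vectors, such an orthant is, up to a null set, an
  increasing union of closed orthants with positive corners, where the measures agree.\<close>

lemma measure_eqI_pos_orthant:
  fixes N1 N2 :: "(real ^ 'd) measure"
  assumes fin: "finite_measure N1"
    and sets: "sets N1 = sets borel" "sets N2 = sets borel"
    and pos: "AE x in N1. \<forall>i. 0 < x $ i" "AE x in N2. \<forall>i. 0 < x $ i"
    and eq: "\<And>a. (\<And>i. 0 < a $ i) \<Longrightarrow>
      emeasure N1 {x. \<forall>i. a $ i \<le> x $ i} = emeasure N2 {x. \<forall>i. a $ i \<le> x $ i}"
  shows "N1 = N2"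
proof (rule measure_eqI_generator_eq)
  define E where "E = range (\<lambda>a::real^'d. {x. eucl_less a x})"
  \<comment> \<open>Clamping the corner at 0 and moving it inwards by \<open>1 / Suc n\<close> keeps
    it positive and lets it tend to the clamped corner.\<close>
  define b where "b a n = (\<chi> i. max (a $ i) 0 + 1 / real (Suc n))" for a :: "real^'d" and n
  have less_iff: "eucl_less a x \<longleftrightarrow> (\<forall>i. a $ i < x $ i)" for a x :: "real^'d"
    by (auto simp: eucl_less_def Basis_vec_def inner_axis)
  have [measurable]: "{x::real^'d. \<forall>i. a $ i \<le> x $ i} \<in> sets borel" for a
    by measurable
  have [measurable]: "{x::real^'d. eucl_less a x} \<in> sets borel" for a
    unfolding less_iff by measurable
  have Un: "(\<Union>n. {x. \<forall>i. b a n $ i \<le> x $ i}) = {x. \<forall>i. max (a $ i) 0 < x $ i}" for a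
  proof (intro set_eqI iffI)
    fix x assume "x \<in> (\<Union>n. {x. \<forall>i. b a n $ i \<le> x $ i})"
    then obtain n where n: "\<And>i. max (a $ i) 0 + 1 / real (Suc n) \<le> x $ i"
      by (auto simp: b_def)
    have "max (a $ i) 0 < x $ i" for i
      using n[of i] by (rule less_le_trans[rotated]) simp
    then show "x \<in> {x. \<forall>i. max (a $ i) 0 < x $ i}" by simp
  next
    fix x assume "x \<in> {x. \<forall>i. max (a $ i) 0 < x $ i}"
    then have x: "max (a $ i) 0 < x $ i" for i by blast
    \<comment> \<open>The smallest gap over the finitely many coordinates yields one
      \<open>n\<close> that serves all of them.\<close>
    define \<delta> where "\<delta> = Min (range (\<lambda>i. x $ i - max (a $ i) 0))"
    have "\<delta> \<in> range (\<lambda>i. x $ i - max (a $ i) 0)"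
      unfolding \<delta>_def by (intro Min_in) auto
    then have "0 < \<delta>" using x by (auto simp: algebra_simps)
    then obtain n where n: "1 / real (Suc n) < \<delta>"
      using nat_approx_posE by blast
    have "\<delta> \<le> x $ i - max (a $ i) 0" for i
      unfolding \<delta>_def by (intro Min_le) auto
    then have "b a n $ i \<le> x $ i" for i
      using n by (simp add: b_def) (smt (verit))
    then show "x \<in> (\<Union>n. {x. \<forall>i. b a n $ i \<le> x $ i})" by blast
  qed
  have inc: "incseq (\<lambda>n. {x. \<forall>i. b a n $ i \<le> x $ i})" for a
  proof (rule incseq_SucI, safe)
    fix n x i assume "\<forall>i. b a n $ i \<le> x $ i"
    then have "b a n $ i \<le> x $ i" by blast
    moreover have "1 / real (Suc (Suc n)) \<le> 1 / real (Suc n)"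
      by (intro divide_left_mono) auto
    ultimately show "b a (Suc n) $ i \<le> x $ i" by (simp add: b_def)
  qed
  have lim: "emeasure N {x. eucl_less a x} = (SUP n. emeasure N {x. \<forall>i. b a n $ i \<le> x $ i})"
    if "sets N = sets borel" "AE x in N. \<forall>i. 0 < x $ i" for N a
  proof -
    note that(1)[measurable_cong]
    have "emeasure N {x. eucl_less a x} = emeasure N {x. \<forall>i. max (a $ i) 0 < x $ i}"
      using that(2) by (intro emeasure_eq_AE) (auto simp: less_iff)
    also have "\<dots> = (SUP n. emeasure N {x. \<forall>i. b a n $ i \<le> x $ i})"
      by (subst SUP_emeasure_incseq) (use inc Un[of a] in \<open>auto simp: that\<close>)
    finally show ?thesis .
  qed
  show "Int_stable E"
  proof (rule Int_stableI)
    fix A B assume "A \<in> E" "B \<in> E"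
    then obtain a c :: "real^'d" where "A = {x. eucl_less a x}" "B = {x. eucl_less c x}" by (auto simp: E_def)
    then have "A \<inter> B = {x. eucl_less (\<chi> i. max (a $ i) (c $ i)) x}" by (auto simp: less_iff)
    then show "A \<inter> B \<in> E" by (auto simp: E_def)
  qed
  show "E \<subseteq> Pow UNIV" by simp
  show "sets N1 = sigma_sets UNIV E" "sets N2 = sigma_sets UNIV E"
    using sets by (simp_all add: E_def borel_eq_greaterThan)
  show "emeasure N1 A = emeasure N2 A" if "A \<in> E" for A
  proof -
    have "0 < b a n $ i" for a n i
      by (simp add: b_def add_nonneg_pos)
    then show ?thesis
      using that by (auto simp: E_def lim[OF sets(1) pos(1)] lim[OF sets(2) pos(2)] eq)
  qed
  show "range (\<lambda>n. {x. eucl_less (\<chi> i. - real n) x}) \<subseteq> E" by (auto simp: E_def)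
  show "(\<Union>n. {x. eucl_less (\<chi> i. - real n) x}) = (UNIV :: (real^'d) set)"
  proof (intro set_eqI iffI UNIV_I)
    fix x :: "real^'d"
    obtain n where n: "Max (range (\<lambda>i. - x $ i)) < real n"
      using reals_Archimedean2 by blast
    have "- x $ i \<le> Max (range (\<lambda>i. - x $ i))" for i by (intro Max_ge) auto
    with n have "- real n < x $ i" for i by (smt (verit))
    then show "x \<in> (\<Union>n. {x. eucl_less (\<chi> i. - real n) x})" by (auto simp: less_iff)
  qed
  show "emeasure N1 {x. eucl_less (\<chi> i. - real n) x} \<noteq> \<infinity>" for n
    using fin by (simp add: finite_measure.emeasure_finite)
qed

section \<open>Probability integral transform for continuous distribution functions\<close>

context prob_space
begin

text \<open>By continuity every level \<open>z\<close> in the open unit interval is a value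
  \<open>F b\<close>. The upper bound compares with \<open>X \<le> b\<close> for levels
  \<open>z > y\<close> and lets \<open>z\<close> decrease to \<open>y\<close>; the lower bound uses
  a point at level \<open>y\<close> itself.\<close>

lemma prob_cdf_le:
  assumes X: "random_variable borel X" and cont: "continuous_on UNIV (cdf (distr M borel X))"
    and y: "0 \<le> y" "y \<le> 1"
  shows "prob {\<omega> \<in> space M. cdf (distr M borel X) (X \<omega>) \<le> y} = y"
proof -
  define F where "F = cdf (distr M borel X)"
  interpret D: real_distribution "distr M borel X" using X by simp
  note X[measurable]
  have mono: "F a \<le> F b" if "a \<le> b" for a b
    unfolding F_def by (rule D.cdf_nondecreasing[OF that])
  have Fm [measurable]: "F \<in> borel_measurable borel"
    unfolding F_def by (rule borel_measurable_continuous_onI[OF cont])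
  have F: "F a = prob {\<omega> \<in> space M. X \<omega> \<le> a}" for a
    unfolding F_def cdf_def by (subst measure_distr) (auto intro!: arg_cong[where f=prob])
  have bot: "(F \<longlongrightarrow> 0) at_bot" and top: "(F \<longlongrightarrow> 1) at_top"
    unfolding F_def by (rule D.cdf_lim_at_bot, rule D.cdf_lim_at_top_prob)
  have ivt: "\<exists>a. F a = z" if z: "0 < z" "z < 1" for z
  proof -
    obtain l where "F l < z"
      using eventually_happens[OF order_tendstoD(2)[OF bot z(1)]] by (auto simp: trivial_limit_at_bot_linorder)
    moreover obtain u where "z < F u"
      using eventually_happens[OF order_tendstoD(1)[OF top z(2)]] by auto
    moreover have "l \<le> u"
      using mono[of u l] calculation by linarith
    ultimately show ?thesis
      using IVT'[of F l z u] cont continuous_on_subset[of UNIV F "{l..u}"] by (fastforce simp: F_def)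
  qed
  have le: "prob {\<omega> \<in> space M. F (X \<omega>) \<le> y} \<le> z" if z: "y < z" "z < 1" for z
  proof -
    obtain b where b: "F b = z" using ivt[of z] y z by auto
    have "{\<omega> \<in> space M. F (X \<omega>) \<le> y} \<subseteq> {\<omega> \<in> space M. X \<omega> \<le> b}"
      using mono z b by (smt (verit) Collect_mono)
    then have "prob {\<omega> \<in> space M. F (X \<omega>) \<le> y} \<le> prob {\<omega> \<in> space M. X \<omega> \<le> b}"
      by (intro finite_measure_mono) auto
    then show ?thesis using b F[of b] by simp
  qed
  have "y \<le> prob {\<omega> \<in> space M. F (X \<omega>) \<le> y}" if y01: "0 < y" "y < 1"
  proof -
    obtain b where b: "F b = y" using ivt[OF y01] by auto
    have "prob {\<omega> \<in> space M. X \<omega> \<le> b} \<le> prob {\<omega> \<in> space M. F (X \<omega>) \<le> y}"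
      using mono b by (intro finite_measure_mono) auto
    then show ?thesis using b F[of b] by simp
  qed
  moreover have "prob {\<omega> \<in> space M. F (X \<omega>) \<le> y} \<le> y" if "y < 1"
    by (rule dense_ge_bounded[OF that]) (rule le)
  moreover have "prob {\<omega> \<in> space M. F (X \<omega>) \<le> 1} = 1"
    unfolding F_def using D.cdf_bounded_prob by (simp add: prob_space)
  ultimately show ?thesis
    using y measure_nonneg[of M "{\<omega> \<in> space M. F (X \<omega>) \<le> y}"] unfolding F_def
    by (cases "y = 0"; cases "y = 1") (auto simp: antisym_conv)
qed

lemma AE_cdf_in_unit:
  assumes X: "random_variable borel X" and cont: "continuous_on UNIV (cdf (distr M borel X))"
  shows "AE \<omega> in M. cdf (distr M borel X) (X \<omega>) \<in> {0<..<1}"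
proof -
  define F where "F = cdf (distr M borel X)"
  interpret D: real_distribution "distr M borel X" using X by simp
  note X[measurable]
  have Fm [measurable]: "F \<in> borel_measurable borel"
    unfolding F_def by (rule borel_measurable_continuous_onI[OF cont])
  have 0: "prob {\<omega> \<in> space M. F (X \<omega>) \<le> 0} = 0"
    using prob_cdf_le[OF X cont, of 0] by (simp add: F_def)
  have "1 - prob {\<omega> \<in> space M. F (X \<omega>) < 1} \<le> z" if "0 < z" "z < 1" for z
  proof -
    have "prob {\<omega> \<in> space M. F (X \<omega>) \<le> 1 - z} \<le> prob {\<omega> \<in> space M. F (X \<omega>) < 1}"
      using that by (intro finite_measure_mono) auto
    then show ?thesis using prob_cdf_le[OF X cont, of "1 - z"] that by (simp add: F_def)
  qed
  then have "1 - prob {\<omega> \<in> space M. F (X \<omega>) < 1} \<le> 0"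
    by (intro dense_ge_bounded[of 0 1]) auto
  then have "prob {\<omega> \<in> space M. F (X \<omega>) < 1} = 1"
    using prob_le_1[of "{\<omega> \<in> space M. F (X \<omega>) < 1}"] by linarith
  then have "AE \<omega> in M. F (X \<omega>) < 1"
    by (subst (asm) prob_Collect_eq_1) auto
  moreover have "AE \<omega> in M. \<not> F (X \<omega>) \<le> 0"
    using 0 by (subst (asm) prob_Collect_eq_0) auto
  ultimately show ?thesis unfolding F_def by auto
qed

text \<open>\<open>F\<close> may be constant to the right of \<open>a\<close>, so the equivalence
  can fail pointwise. The two events are nested and both have probability \<open>F a\<close>, so
  they differ by a null set.\<close>

lemma AE_le_iff_cdf_le:
  assumes X: "random_variable borel X" and cont: "continuous_on UNIV (cdf (distr M borel X))"
  shows "AE \<omega> in M. X \<omega> \<le> a \<longleftrightarrow> cdf (distr M borel X) (X \<omega>) \<le> cdf (distr M borel X) a"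
proof -
  define F where "F = cdf (distr M borel X)"
  interpret D: real_distribution "distr M borel X" using X by simp
  note X[measurable]
  have Fm [measurable]: "F \<in> borel_measurable borel"
    unfolding F_def by (rule borel_measurable_continuous_onI[OF cont])
  have mono: "F x \<le> F b" if "x \<le> b" for x b
    unfolding F_def by (rule D.cdf_nondecreasing[OF that])
  have "prob {\<omega> \<in> space M. F (X \<omega>) \<le> F a} = F a"
    using prob_cdf_le[OF X cont, of "F a"] by (simp add: F_def D.cdf_nonneg D.cdf_bounded_prob)
  moreover have "prob {\<omega> \<in> space M. X \<omega> \<le> a} = F a"
    unfolding F_def cdf_def by (subst measure_distr) (auto intro!: arg_cong[where f=prob])
  moreover have "{\<omega> \<in> space M. F (X \<omega>) \<le> F a} - {\<omega> \<in> space M. X \<omega> \<le> a} =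
      {\<omega> \<in> space M. F (X \<omega>) \<le> F a \<and> \<not> X \<omega> \<le> a}" by auto
  moreover have "prob ({\<omega> \<in> space M. F (X \<omega>) \<le> F a} - {\<omega> \<in> space M. X \<omega> \<le> a}) =
      prob {\<omega> \<in> space M. F (X \<omega>) \<le> F a} - prob {\<omega> \<in> space M. X \<omega> \<le> a}"
    using mono by (intro finite_measure_Diff) auto
  ultimately have "prob {\<omega> \<in> space M. F (X \<omega>) \<le> F a \<and> \<not> X \<omega> \<le> a} = 0" by simp
  then have "AE \<omega> in M. \<not> (F (X \<omega>) \<le> F a \<and> \<not> X \<omega> \<le> a)"
    by (subst (asm) prob_Collect_eq_0) auto
  then show ?thesis
    unfolding F_def[symmetric] using mono by auto
qed

end

subsection \<open>Mixtures of exponential distributions\<close>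

lemma nn_integral_exp_atLeast:
  fixes z a :: real
  assumes "0 < z"
  shows "(\<integral>\<^sup>+x. ennreal (z * exp (- z * x)) * indicator {a..} x \<partial>lborel) = ennreal (exp (- z * a))"
proof -
  have "((\<lambda>x. - exp (- z * x)) \<longlongrightarrow> - 0) at_top"
    by (intro tendsto_minus filterlim_compose[OF exp_at_bot] filterlim_tendsto_neg_mult_at_bot[of _ "-z"])
       (use assms in \<open>auto simp: filterlim_ident\<close>)
  then have "(\<integral>\<^sup>+x. ennreal (z * exp (- z * x)) * indicator {a..} x \<partial>lborel) =
      - 0 - (- exp (- z * a))"
    using assms by (intro nn_integral_FTC_atLeast) (auto intro!: derivative_eq_intros)
  then show ?thesis by simp
qed

lemma nn_integral_orthant_prod:
  fixes f :: "real \<Rightarrow> ennreal" and a :: "real ^ 'd"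
  assumes [measurable]: "f \<in> borel_measurable borel"
  shows "(\<integral>\<^sup>+x. (\<Prod>i\<in>UNIV. f (x $ i) * indicator {a $ i..} (x $ i)) \<partial>lborel) =
    (\<Prod>i\<in>UNIV. \<integral>\<^sup>+x. f x * indicator {a $ i..} x \<partial>lborel)"
proof -
  have reidx: "(\<Prod>b\<in>Basis. g b) = (\<Prod>i\<in>UNIV. g (axis i 1))" for g :: "real^'d \<Rightarrow> ennreal"
  proof -
    have B: "(Basis :: (real^'d) set) = range (\<lambda>i. axis i 1)" by (auto simp: Basis_vec_def)
    have "inj (\<lambda>i::'d. axis i (1::real))" by (auto simp: inj_on_def axis_eq_axis)
    then show ?thesis unfolding B by (subst prod.reindex) (simp_all add: o_def)
  qed
  have "(\<integral>\<^sup>+x. (\<Prod>b\<in>Basis. f (x \<bullet> b) * indicator {a \<bullet> b..} (x \<bullet> b)) \<partial>lborel) =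
    (\<Prod>b\<in>Basis. \<integral>\<^sup>+x. f x * indicator {a \<bullet> b..} x \<partial>lborel)"
    by (rule nn_integral_lborel_prod[where f="\<lambda>b x. f x * indicator {a \<bullet> b..} x"]) auto
  then show ?thesis unfolding reidx by (simp add: inner_axis)
qed

text \<open>The mixing measure is placed on the whole real line to have plain Borel sets. Positivity
  almost everywhere excludes an atom at 0, and \<open>\<psi> 1 \<noteq> 0\<close> excludes the zero
  measure.\<close>

locale laplace_transform =
  fixes \<nu> :: "real measure" and \<psi> :: "real \<Rightarrow> real"
  assumes sets_\<nu> [measurable_cong, simp]: "sets \<nu> = sets borel"
    and AE_pos: "AE z in \<nu>. 0 < z"
    and transform: "0 < u \<Longrightarrow> has_bochner_integral \<nu> (\<lambda>z. exp (- u * z)) (\<psi> u)"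
    and nonzero: "\<psi> 1 \<noteq> 0"
begin

lemma space_\<nu> [simp]: "space \<nu> = UNIV"
  using sets_eq_imp_space_eq[OF sets_\<nu>] by simp

sublocale sigma_finite_measure \<nu>
proof
  show "\<exists>A. countable A \<and> A \<subseteq> sets \<nu> \<and> \<Union> A = space \<nu> \<and> (\<forall>a\<in>A. emeasure \<nu> a \<noteq> \<infinity>)"
  proof (intro exI conjI ballI)
    show "countable (range (\<lambda>n::nat. {..real n}))" by simp
    show "\<Union> (range (\<lambda>n::nat. {..real n})) = space \<nu>"
      by (auto intro: real_arch_simple)
    fix A assume "A \<in> range (\<lambda>n::nat. {..real n})"
    then obtain n where A: "A = {..real n}" by auto
    have "emeasure \<nu> A = (\<integral>\<^sup>+z. indicator A z \<partial>\<nu>)" by (simp add: A)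
    \<comment> \<open>On \<open>{..n}\<close> the product \<open>exp n * exp (- z)\<close> is at
      least 1, so the finite transform at 1 bounds the mass.\<close>
    also have "\<dots> \<le> (\<integral>\<^sup>+z. ennreal (exp n) * ennreal (exp (- 1 * z)) \<partial>\<nu>)"
      by (intro nn_integral_mono)
         (auto simp: A indicator_def ennreal_mult[symmetric] exp_add[symmetric] intro!: ennreal_leI)
    also have "\<dots> = ennreal (exp n) * (\<integral>\<^sup>+z. ennreal (exp (- 1 * z)) \<partial>\<nu>)"
      by (rule nn_integral_cmult) simp
    also have "(\<integral>\<^sup>+z. ennreal (exp (- 1 * z)) \<partial>\<nu>) = ennreal (\<psi> 1)"
      using transform[of 1] by (subst nn_integral_eq_integral) (auto simp: has_bochner_integral_iff)
    finally show "emeasure \<nu> A \<noteq> \<infinity>" by (auto simp: ennreal_mult[symmetric] top_unique ennreal_mult_eq_top_iff)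
  qed auto
qed

section \<open>Weighted moments of the mixing measure and their ratios\<close>

definition mom :: "nat \<Rightarrow> real \<Rightarrow> real" where
  "mom d s = (\<integral>z. z ^ d * exp (- s * z) \<partial>\<nu>)"

lemma mom_measurable [measurable]: "mom d \<in> borel_measurable borel"
  unfolding mom_def by measurable

lemma mom_integrable:
  assumes "0 < s"
  shows "integrable \<nu> (\<lambda>z. z ^ d * exp (- s * z))"
proof (cases "d = 0")
  case True
  then show ?thesis using transform[OF assms] by (auto simp: has_bochner_integral_iff)
next
  case False
  \<comment> \<open>The power \<open>z ^ d\<close> is absorbed by half of the exponential. The
    constant comes from \<open>x \<le> exp x\<close> at \<open>x = s * z / (2 * d)\<close>, raised
    to the power \<open>d\<close>.\<close>
  define c where "c = (2 * real d / s) ^ d"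
  have bound: "z ^ d * exp (- s * z) \<le> c * exp (- (s / 2) * z)" if z: "0 < z" for z
  proof -
    have "s * z / (2 * real d) \<le> exp (s * z / (2 * real d))"
      using exp_ge_add_one_self[of "s * z / (2 * real d)"] by linarith
    then have "(s * z / (2 * real d)) ^ d \<le> exp (s * z / (2 * real d)) ^ d"
      using assms z by (intro power_mono) auto
    also have "\<dots> = exp (s * z / 2)"
      using False by (simp add: exp_of_nat_mult[symmetric] field_simps)
    finally have "c * (s * z / (2 * real d)) ^ d \<le> c * exp (s * z / 2)"
      using assms by (intro mult_left_mono) (auto simp: c_def)
    moreover have "c * (s * z / (2 * real d)) ^ d = z ^ d"
      using assms False by (simp add: c_def power_mult_distrib[symmetric])
    ultimately have "z ^ d * exp (- s * z) \<le> c * exp (s * z / 2) * exp (- s * z)"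
      by (intro mult_right_mono) auto
    also have "\<dots> = c * exp (- (s / 2) * z)"
      by (simp add: exp_add[symmetric] mult.assoc)
    finally show ?thesis .
  qed
  show ?thesis
  proof (rule Bochner_Integration.integrable_bound)
    show "integrable \<nu> (\<lambda>z. c * exp (- (s / 2) * z))"
      using transform[of "s / 2"] assms by (auto simp: has_bochner_integral_iff)
    show "AE z in \<nu>. norm (z ^ d * exp (- s * z)) \<le> norm (c * exp (- (s / 2) * z))"
      using AE_pos
    proof eventually_elim
      case (elim z)
      have "0 \<le> c" using assms by (simp add: c_def)
      with elim bound[of z] show ?case by (simp add: abs_mult)
    qed
  qed simp
qed

text \<open>A zero integral would force the positive integrand to vanish almost everywhere, so
  \<open>\<nu>\<close> would be null, against \<open>\<psi> 1 \<noteq> 0\<close>.\<close>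

lemma integral_pos:
  fixes f :: "real \<Rightarrow> real"
  assumes f: "integrable \<nu> f" and pos: "\<And>z. 0 < z \<Longrightarrow> 0 < f z"
  shows "0 < (\<integral>z. f z \<partial>\<nu>)"
proof -
  have nn: "AE z in \<nu>. 0 \<le> f z"
    using AE_pos by eventually_elim (auto intro: less_imp_le pos)
  have "(\<integral>z. f z \<partial>\<nu>) \<noteq> 0"
  proof
    assume "(\<integral>z. f z \<partial>\<nu>) = 0"
    then have "AE z in \<nu>. f z = 0"
      using integral_nonneg_eq_0_iff_AE[OF f nn] by simp
    with AE_pos have "AE z in \<nu>. False" by eventually_elim (use pos in force)
    then have "(\<integral>z. exp (- 1 * z) \<partial>\<nu>) = (\<integral>z. 0 \<partial>\<nu>)"
      by (intro integral_cong_AE) auto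
    with transform[of 1] nonzero show False by (auto simp: has_bochner_integral_iff)
  qed
  then show ?thesis using integral_nonneg_AE[OF nn] by linarith
qed

lemma mom_pos: "0 < s \<Longrightarrow> 0 < mom d s"
  unfolding mom_def by (intro integral_pos mom_integrable) auto

text \<open>For positive arguments \<open>mom d\<close> is the \<open>d\<close>-th derivative of
  \<open>\<psi>\<close> up to sign, and this is its log-convexity without quotients. It supplies the
  monotone likelihood ratio.\<close>

lemma mom_ratio_mono:
  assumes s: "0 < s" "s \<le> s'" and t: "0 < t"
  shows "mom d (s + t) * mom d s' \<le> mom d (s' + t) * mom d s"
proof -
  \<comment> \<open>\<open>exp (- t * z) - r\<close> changes sign at \<open>z0\<close>, so replacing the increasing weight
    \<open>exp (z * (s' - s))\<close> by its value at \<open>z0\<close> can only increase the product.\<close>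
  define r where "r = mom d (s' + t) / mom d s'"
  define z0 where "z0 = - ln r / t"
  have pos: "0 < mom d s'" "0 < mom d (s' + t)" using s t by (auto intro!: mom_pos)
  then have r: "exp (- t * z0) = r" using t by (simp add: r_def z0_def)
  have split: "z ^ d * exp (- (u + t) * z) - r * (z ^ d * exp (- u * z)) =
      z ^ d * (exp (- u * z) * (exp (- t * z) - r))" for u z
    by (simp add: algebra_simps exp_add[symmetric])
  have le: "exp (- s * z) * (exp (- t * z) - r)
      \<le> exp (z0 * (s' - s)) * (exp (- s' * z) * (exp (- t * z) - r))" for z
  proof -
    have eq: "exp (- s * z) = exp (z * (s' - s)) * exp (- s' * z)"
      by (simp add: exp_add[symmetric] algebra_simps)
    have "exp (z * (s' - s)) * (exp (- t * z) - r) \<le> exp (z0 * (s' - s)) * (exp (- t * z) - r)"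
    proof (cases "z \<le> z0")
      case True
      then have "0 \<le> exp (- t * z) - r" using t by (simp add: r[symmetric])
      with True s show ?thesis by (intro mult_right_mono) (auto intro!: mult_right_mono)
    next
      case False
      then have "exp (- t * z) - r \<le> 0" using t by (simp add: r[symmetric])
      with False s show ?thesis by (intro mult_right_mono_neg) (auto intro!: mult_right_mono)
    qed
    then have "exp (- s' * z) * (exp (z * (s' - s)) * (exp (- t * z) - r))
        \<le> exp (- s' * z) * (exp (z0 * (s' - s)) * (exp (- t * z) - r))"
      by (intro mult_left_mono) auto
    then show ?thesis unfolding eq by (simp add: mult_ac)
  qed
  have int: "integrable \<nu> (\<lambda>z. z ^ d * exp (- (u + t) * z) - r * (z ^ d * exp (- u * z)))"
    and int_eq: "(\<integral>z. z ^ d * exp (- (u + t) * z) - r * (z ^ d * exp (- u * z)) \<partial>\<nu>) =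
      mom d (u + t) - r * mom d u" if "0 < u" for u
    using mom_integrable[of "u + t" d] mom_integrable[of u d] that t by (simp_all add: mom_def)
  have "mom d (s + t) - r * mom d s =
      (\<integral>z. z ^ d * exp (- (s + t) * z) - r * (z ^ d * exp (- s * z)) \<partial>\<nu>)"
    using s by (simp only: int_eq)
  also have "\<dots> \<le> (\<integral>z. exp (z0 * (s' - s)) *
      (z ^ d * exp (- (s' + t) * z) - r * (z ^ d * exp (- s' * z))) \<partial>\<nu>)"
  proof (rule integral_mono_AE)
    show "AE z in \<nu>. z ^ d * exp (- (s + t) * z) - r * (z ^ d * exp (- s * z)) \<le>
        exp (z0 * (s' - s)) * (z ^ d * exp (- (s' + t) * z) - r * (z ^ d * exp (- s' * z)))"
      using AE_pos
    proof eventually_elim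
      case (elim z)
      then show ?case
        unfolding split using mult_left_mono[OF le[of z], of "z ^ d"] by (simp add: mult_ac)
    qed
  qed (use int s in auto)
  also have "\<dots> = exp (z0 * (s' - s)) * (mom d (s' + t) - r * mom d s')"
    using s int_eq[of s'] by (simp only: Bochner_Integration.integral_mult_right_zero)
  \<comment> \<open>\<open>r\<close> was chosen as the ratio of the moments at \<open>s'\<close>
    exactly to make this difference vanish.\<close>
  also have "\<dots> = 0" using pos by (simp add: r_def)
  finally have "mom d (s + t) \<le> r * mom d s" by simp
  then show ?thesis using pos by (simp add: r_def field_simps)
qed

text \<open>
  For a probability measure \<open>\<nu>\<close> and \<open>t = 0\<close> this is the law of a vector whose coordinates are,
  given \<open>z\<close> distributed as \<open>\<nu>\<close>, independent exponentials of rate \<open>z\<close>; a positive \<open>t\<close> inserts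
  the additional weight \<open>exp (- t * z)\<close>.
\<close>

definition law :: "real \<Rightarrow> (real ^ 'd) measure" where
  "law t = density lborel
     (\<lambda>e. indicator {e. \<forall>i. 0 < e $ i} e * ennreal (mom CARD('d) (t + (\<Sum>i\<in>UNIV. e $ i))))"

lemma sets_law [measurable_cong, simp]: "sets (law t) = sets borel"
  by (simp add: law_def)

lemma law_measurable_density [measurable]:
  "(\<lambda>e::real^'d. indicator {e. \<forall>i. 0 < e $ i} e * ennreal (mom CARD('d) (t + (\<Sum>i\<in>UNIV. e $ i))))
    \<in> borel_measurable borel"
  by measurable

lemma AE_law_pos: "AE e in law t. \<forall>i. 0 < (e :: real^'d) $ i"
  unfolding law_def by (subst AE_density) (auto simp: indicator_def)

text \<open>Write \<open>mom\<close> as an integral over \<open>z\<close> and exchange the order of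
  integration. For fixed \<open>z\<close> the integrand splits into exponential densities, the
  factor \<open>z ^ n\<close> giving one rate \<open>z\<close> per coordinate; their tails multiply
  to \<open>exp (- z * (\<Sum>i\<in>UNIV. a $ i))\<close>, and the transform returns
  \<open>\<psi>\<close>.\<close>

lemma emeasure_law_orthant:
  fixes a :: "real ^ 'd"
  assumes a: "\<And>i. 0 < a $ i" and t: "0 \<le> t"
  shows "emeasure (law t) {e. \<forall>i. a $ i \<le> e $ i} = ennreal (\<psi> (t + (\<Sum>i\<in>UNIV. a $ i)))"
proof -
  define Q where "Q = {e::real^'d. \<forall>i. a $ i \<le> e $ i}"
  define n where "n = CARD('d)"
  have Q [measurable]: "Q \<in> sets borel" unfolding Q_def by measurable
  \<comment> \<open>When \<open>t = 0\<close>, only the sum of the coordinates keeps the argument of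
    \<open>mom\<close> positive, as its integrability requires.\<close>
  have Q_sum_pos: "0 < (\<Sum>i\<in>UNIV. e $ i)" if "e \<in> Q" for e
    using that a by (intro sum_pos) (auto simp: Q_def intro: less_le_trans)
  have "emeasure (law t) Q = (\<integral>\<^sup>+e. indicator {e. \<forall>i. 0 < e $ i} e *
      ennreal (mom n (t + (\<Sum>i\<in>UNIV. e $ i))) * indicator Q e \<partial>lborel)"
    unfolding law_def n_def by (rule emeasure_density) auto
  also have "\<dots> = (\<integral>\<^sup>+e. \<integral>\<^sup>+z. indicator Q e * ennreal (z ^ n * exp (- (t + (\<Sum>i\<in>UNIV. e $ i)) * z)) \<partial>\<nu> \<partial>lborel)"
  proof (rule nn_integral_cong)
    fix e :: "real^'d"
    show "indicator {e. \<forall>i. 0 < e $ i} e * ennreal (mom n (t + (\<Sum>i\<in>UNIV. e $ i))) * indicator Q e =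
      (\<integral>\<^sup>+z. indicator Q e * ennreal (z ^ n * exp (- (t + (\<Sum>i\<in>UNIV. e $ i)) * z)) \<partial>\<nu>)"
    proof (cases "e \<in> Q")
      case True
      have "(\<integral>\<^sup>+z. ennreal (z ^ n * exp (- (t + (\<Sum>i\<in>UNIV. e $ i)) * z)) \<partial>\<nu>) =
          ennreal (mom n (t + (\<Sum>i\<in>UNIV. e $ i)))"
        unfolding mom_def
      proof (rule nn_integral_eq_integral)
        show "integrable \<nu> (\<lambda>z. z ^ n * exp (- (t + (\<Sum>i\<in>UNIV. e $ i)) * z))"
          using Q_sum_pos[OF True] t by (intro mom_integrable) auto
        show "AE z in \<nu>. 0 \<le> z ^ n * exp (- (t + (\<Sum>i\<in>UNIV. e $ i)) * z)"
          using AE_pos by eventually_elim auto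
      qed
      moreover have "0 < e $ i" for i using True a[of i] by (auto simp: Q_def intro: less_le_trans)
      ultimately show ?thesis using True by simp
    qed simp
  qed
  also have "\<dots> = (\<integral>\<^sup>+z. \<integral>\<^sup>+e. indicator Q e * ennreal (z ^ n * exp (- (t + (\<Sum>i\<in>UNIV. e $ i)) * z)) \<partial>lborel \<partial>\<nu>)"
  proof -
    interpret pair_sigma_finite "lborel :: (real^'d) measure" \<nu> ..
    have [measurable]: "(\<lambda>x. fst x $ i) \<in> borel_measurable ((borel :: (real^'d) measure) \<Otimes>\<^sub>M (borel :: real measure))" for i
      by (rule measurable_compose[OF measurable_fst]) measurable
    have [measurable]: "snd \<in> borel_measurable ((lborel :: (real^'d) measure) \<Otimes>\<^sub>M \<nu>)"
      by (simp cong: measurable_cong_sets)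
    show ?thesis by (rule Fubini'[symmetric]) measurable
  qed
  also have "\<dots> = (\<integral>\<^sup>+z. ennreal (exp (- (t + (\<Sum>i\<in>UNIV. a $ i)) * z)) \<partial>\<nu>)"
  proof (rule nn_integral_cong_AE)
    show "AE z in \<nu>. (\<integral>\<^sup>+e. indicator Q e * ennreal (z ^ n * exp (- (t + (\<Sum>i\<in>UNIV. e $ i)) * z)) \<partial>lborel) =
        ennreal (exp (- (t + (\<Sum>i\<in>UNIV. a $ i)) * z))"
      using AE_pos
    proof eventually_elim
      case (elim z)
      have "(\<integral>\<^sup>+e. indicator Q e * ennreal (z ^ n * exp (- (t + (\<Sum>i\<in>UNIV. e $ i)) * z)) \<partial>lborel) =
        (\<integral>\<^sup>+e. ennreal (exp (- t * z)) *
          (\<Prod>i\<in>UNIV. ennreal (z * exp (- z * e $ i)) * indicator {a $ i..} (e $ i)) \<partial>lborel)"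
      proof (rule nn_integral_cong)
        fix e :: "real^'d"
        have "(\<Prod>i\<in>UNIV. ennreal (z * exp (- z * e $ i)) * indicator {a $ i..} (e $ i)) =
            ennreal (\<Prod>i\<in>UNIV. z * exp (- z * e $ i)) * (\<Prod>i\<in>UNIV. indicator {a $ i..} (e $ i))"
          using elim by (simp add: prod.distrib prod_ennreal)
        also have "(\<Prod>i\<in>UNIV. z * exp (- z * e $ i)) = z ^ n * exp (- z * (\<Sum>i\<in>UNIV. e $ i))"
          by (simp add: prod.distrib n_def exp_sum[symmetric] sum_distrib_left sum_negf)
        also have "(\<Prod>i\<in>UNIV. indicator {a $ i..} (e $ i)) = (indicator Q e :: ennreal)"
        proof (cases "e \<in> Q")
          case False
          then obtain i where "\<not> a $ i \<le> e $ i" by (auto simp: Q_def)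
          then show ?thesis using False by (auto intro!: exI[of _ i])
        qed (simp add: Q_def)
        finally show "indicator Q e * ennreal (z ^ n * exp (- (t + (\<Sum>i\<in>UNIV. e $ i)) * z)) =
            ennreal (exp (- t * z)) *
            (\<Prod>i\<in>UNIV. ennreal (z * exp (- z * e $ i)) * indicator {a $ i..} (e $ i))"
          using elim by (simp add: ennreal_mult[symmetric] mult_ac exp_add[symmetric] algebra_simps split: split_indicator)
      qed
      also have "\<dots> = ennreal (exp (- t * z)) * (\<integral>\<^sup>+e.
          (\<Prod>i\<in>UNIV. ennreal (z * exp (- z * e $ i)) * indicator {a $ i..} (e $ i)) \<partial>lborel)"
        by (rule nn_integral_cmult) measurable
      also have "(\<integral>\<^sup>+e. (\<Prod>i\<in>UNIV. ennreal (z * exp (- z * e $ i)) * indicator {a $ i..} (e $ i)) \<partial>lborel) =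
          (\<Prod>i\<in>UNIV. ennreal (exp (- z * a $ i)))"
        by (subst nn_integral_orthant_prod[where f="\<lambda>x. ennreal (z * exp (- z * x))"])
           (simp, simp only: nn_integral_exp_atLeast[OF elim])
      also have "ennreal (exp (- t * z)) * \<dots> = ennreal (exp (- (t + (\<Sum>i\<in>UNIV. a $ i)) * z))"
        by (simp add: prod_ennreal exp_sum[symmetric] ennreal_mult[symmetric] exp_add[symmetric])
           (simp add: algebra_simps sum_negf sum_distrib_left)
      finally show ?case .
    qed
  qed
  also have "\<dots> = ennreal (\<psi> (t + (\<Sum>i\<in>UNIV. a $ i)))"
  proof -
    have "0 < t + (\<Sum>i\<in>UNIV. a $ i)"
      using t a by (intro add_nonneg_pos sum_pos) auto
    from transform[OF this] show ?thesis
      by (subst nn_integral_eq_integral) (auto simp: has_bochner_integral_iff)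
  qed
  finally show ?thesis by (simp add: Q_def)
qed

section \<open>Strict monotonicity and the Neyman--Pearson comparison\<close>

lemma psi_strict_antimono:
  assumes "0 < u" "u < v"
  shows "\<psi> v < \<psi> u"
proof -
  have "has_bochner_integral \<nu> (\<lambda>z. exp (- u * z) - exp (- v * z)) (\<psi> u - \<psi> v)"
    using assms by (intro has_bochner_integral_diff transform) auto
  moreover have "0 < (\<integral>z. exp (- u * z) - exp (- v * z) \<partial>\<nu>)"
    using calculation assms by (intro integral_pos) (auto simp: has_bochner_integral_iff)
  ultimately show ?thesis by (simp add: has_bochner_integral_iff)
qed

text \<open>\<open>r\<close> is the likelihood ratio of \<open>law t\<close> to \<open>law 0\<close>
  where the coordinates sum to \<open>s0\<close>. By \<open>mom_ratio_mono\<close> it bounds the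
  ratio from above at smaller sums and from below at larger ones, and the pointwise bounds are
  integrated over \<open>S\<close>.\<close>

lemma
  fixes S :: "(real ^ 'd) set"
  assumes S [measurable]: "S \<in> sets borel" and s0: "0 < s0" and t: "0 < t"
  defines "r \<equiv> ennreal (mom CARD('d) (s0 + t) / mom CARD('d) s0)"
  shows emeasure_law_le: "S \<subseteq> {e. (\<Sum>i\<in>UNIV. e $ i) \<le> s0} \<Longrightarrow>
      emeasure (law t) S \<le> r * emeasure (law 0) S"
    and emeasure_law_ge: "S \<subseteq> {e. s0 \<le> (\<Sum>i\<in>UNIV. e $ i)} \<Longrightarrow>
      r * emeasure (law 0) S \<le> emeasure (law t) S"
proof -
  let ?n = "CARD('d)"
  let ?P = "\<lambda>e::real^'d. indicator {e. \<forall>i. 0 < e $ i} e :: ennreal"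
  let ?s = "\<lambda>e::real^'d. \<Sum>i\<in>UNIV. e $ i"
  have eq: "emeasure (law u) S = (\<integral>\<^sup>+e. ?P e * ennreal (mom ?n (u + ?s e)) * indicator S e \<partial>lborel)" for u
    unfolding law_def by (rule emeasure_density) auto
  have eq0: "r * emeasure (law 0) S =
      (\<integral>\<^sup>+e. r * (?P e * ennreal (mom ?n (0 + ?s e)) * indicator S e) \<partial>lborel)"
    unfolding eq by (rule nn_integral_cmult[symmetric]) measurable
  have pos: "0 < ?s e" if "\<forall>i. 0 < e $ i" for e
    using that by (intro sum_pos) auto
  have m0: "0 < mom ?n s0" "0 < mom ?n (s0 + t)" using s0 t by (auto intro!: mom_pos)
  have r: "r * ennreal (mom ?n s) = ennreal (mom ?n (s0 + t) / mom ?n s0 * mom ?n s)" if "0 < s" for s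
    unfolding r_def using m0 mom_pos[OF that, of ?n] by (subst ennreal_mult) auto
  show "emeasure (law t) S \<le> r * emeasure (law 0) S" if S: "S \<subseteq> {e. ?s e \<le> s0}"
    unfolding eq[of t] eq0
  proof (rule nn_integral_mono)
    fix e :: "real^'d"
    show "?P e * ennreal (mom ?n (t + ?s e)) * indicator S e \<le>
        r * (?P e * ennreal (mom ?n (0 + ?s e)) * indicator S e)"
    proof (cases "e \<in> S \<and> (\<forall>i. 0 < e $ i)")
      case True
      then have "mom ?n (t + ?s e) * mom ?n s0 \<le> mom ?n (s0 + t) * mom ?n (?s e)"
        using mom_ratio_mono[of "?s e" s0 t ?n] pos[of e] S t by (auto simp: add.commute)
      then have "mom ?n (t + ?s e) \<le> mom ?n (s0 + t) / mom ?n s0 * mom ?n (?s e)"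
        using m0 by (simp add: field_simps)
      then show ?thesis using True r[OF pos[of e]] by (simp add: ennreal_leI)
    qed (auto simp: indicator_def)
  qed
  show "r * emeasure (law 0) S \<le> emeasure (law t) S" if S: "S \<subseteq> {e. s0 \<le> ?s e}"
    unfolding eq[of t] eq0
  proof (rule nn_integral_mono)
    fix e :: "real^'d"
    show "r * (?P e * ennreal (mom ?n (0 + ?s e)) * indicator S e) \<le>
        ?P e * ennreal (mom ?n (t + ?s e)) * indicator S e"
    proof (cases "e \<in> S \<and> (\<forall>i. 0 < e $ i)")
      case True
      then have "mom ?n (s0 + t) * mom ?n (?s e) \<le> mom ?n (t + ?s e) * mom ?n s0"
        using mom_ratio_mono[of s0 "?s e" t ?n] s0 S t by (auto simp: add.commute)
      then have "mom ?n (s0 + t) / mom ?n s0 * mom ?n (?s e) \<le> mom ?n (t + ?s e)"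
        using m0 by (simp add: field_simps)
      then show ?thesis using True r[OF pos[of e]] by (simp add: ennreal_leI)
    qed (auto simp: indicator_def)
  qed
qed

text \<open>Neyman--Pearson exchange: under \<open>law 0\<close> the parts \<open>B - A\<close> and
  \<open>A - B\<close> have equal mass. The first lies below the level \<open>s0\<close> and the
  second does not, so under \<open>law t\<close> the factor \<open>r\<close> separates their
  masses.\<close>

lemma law_sublevel_minimal:
  fixes A :: "(real ^ 'd) set"
  assumes A [measurable]: "A \<in> sets borel" and s0: "0 < s0" and t: "0 < t"
    and fin: "finite_measure (law 0 :: (real ^ 'd) measure)"
    and eq: "emeasure (law 0) A = emeasure (law 0) {e :: real ^ 'd. (\<Sum>i\<in>UNIV. e $ i) < s0}"
  shows "emeasure (law t) {e :: real ^ 'd. (\<Sum>i\<in>UNIV. e $ i) < s0} \<le> emeasure (law t) A"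
proof -
  interpret finite_measure "law 0 :: (real^'d) measure" by (rule fin)
  define B where "B = {e::real^'d. (\<Sum>i\<in>UNIV. e $ i) < s0}"
  define r where "r = ennreal (mom CARD('d) (s0 + t) / mom CARD('d) s0)"
  have B [measurable]: "B \<in> sets borel" unfolding B_def by measurable
  have split: "emeasure (law u) C = emeasure (law u) (C \<inter> D) + emeasure (law u) (C - D)"
    if [measurable]: "C \<in> sets borel" "D \<in> sets borel" for C D :: "(real^'d) set" and u
  proof -
    have "emeasure (law u) (C \<inter> D) + emeasure (law u) (C - D) = emeasure (law u) ((C \<inter> D) \<union> (C - D))"
      by (rule plus_emeasure) auto
    moreover have "(C \<inter> D) \<union> (C - D) = C" by auto
    ultimately show ?thesis by simp
  qed
  have "emeasure (law 0) (A \<inter> B) + emeasure (law 0) (A - B) = emeasure (law 0) A"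
    by (rule split[symmetric]) auto
  also have "\<dots> = emeasure (law 0) B" unfolding B_def by (rule eq)
  also have "\<dots> = emeasure (law 0) (A \<inter> B) + emeasure (law 0) (B - A)"
    by (subst Int_commute) (rule split; simp)
  finally have "emeasure (law 0) (A \<inter> B) + emeasure (law 0) (A - B) =
      emeasure (law 0) (A \<inter> B) + emeasure (law 0) (B - A)" .
  \<comment> \<open>Cancelling the common part is legitimate because \<open>law 0\<close> is
    finite.\<close>
  then have diff: "emeasure (law 0) (B - A) = emeasure (law 0) (A - B)"
    unfolding ennreal_add_left_cancel by simp
  have "emeasure (law t) B = emeasure (law t) (A \<inter> B) + emeasure (law t) (B - A)"
    using split[of B A t] by (simp add: Int_commute)
  also have "emeasure (law t) (B - A) \<le> r * emeasure (law 0) (B - A)"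
    unfolding r_def by (rule emeasure_law_le) (use s0 t in \<open>auto simp: B_def\<close>)
  also have "\<dots> = r * emeasure (law 0) (A - B)" by (simp only: diff)
  also have "\<dots> \<le> emeasure (law t) (A - B)"
    unfolding r_def by (rule emeasure_law_ge) (use s0 t in \<open>auto simp: B_def\<close>)
  also have "emeasure (law t) (A \<inter> B) + \<dots> = emeasure (law t) A"
    using split[of A B t] by simp
  finally show ?thesis by (simp add: B_def add_left_mono)
qed

lemma emeasure_law_sublevel_pos:
  assumes s0: "0 < s0"
  shows "emeasure (law 0) {e::real^'d. (\<Sum>i\<in>UNIV. e $ i) < s0} \<noteq> 0"
proof
  let ?n = "CARD('d)"
  define B where "B = {e::real^'d. (\<Sum>i\<in>UNIV. e $ i) < s0}"
  have B [measurable]: "B \<in> sets borel" unfolding B_def by measurable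
  \<comment> \<open>The open box from 0 to \<open>u\<close> has coordinate sums below
    \<open>s0\<close> and positive volume, and the density is positive on it.\<close>
  define u :: "real^'d" where "u = (\<chi> i. s0 / real ?n)"
  have box: "e \<in> B \<and> (\<forall>i. 0 < e $ i)" if "e \<in> box 0 u" for e
  proof -
    have e: "0 < e $ i" "e $ i < s0 / real ?n" for i
      using that by (auto simp: mem_box_cart u_def)
    have "(\<Sum>i\<in>UNIV. e $ i) < (\<Sum>i::'d\<in>UNIV. s0 / real ?n)"
      by (rule sum_strict_mono) (use e in auto)
    then show ?thesis using e by (simp add: B_def)
  qed
  assume "emeasure (law 0) {e::real^'d. (\<Sum>i\<in>UNIV. e $ i) < s0} = 0"
  then have "B \<in> null_sets (law 0)" by (simp add: null_sets_def B_def[symmetric])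
  then have "AE e in lborel. e \<in> B \<longrightarrow>
      indicator {e. \<forall>i. 0 < e $ i} e * ennreal (mom ?n (0 + (\<Sum>i\<in>UNIV. e $ i))) = 0"
    unfolding law_def by (subst (asm) null_sets_density_iff) auto
  then have "AE e in lborel. e \<notin> box 0 u"
  proof eventually_elim
    case (elim e)
    show ?case
    proof
      assume "e \<in> box 0 u"
      from box[OF this] have e: "e \<in> B" "\<forall>i. 0 < e $ i" by auto
      then have "0 < (\<Sum>i\<in>UNIV. e $ i)" by (intro sum_pos) auto
      with e elim mom_pos[of "\<Sum>i\<in>UNIV. e $ i" ?n] show False by simp
    qed
  qed
  then have "emeasure lborel (box 0 u) = 0"
    by (subst (asm) AE_iff_measurable[of "box 0 u"]) auto
  moreover have "emeasure lborel (box 0 u) = ennreal (\<Prod>b\<in>Basis. (u - 0) \<bullet> b)"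
    by (rule emeasure_lborel_box) (use s0 in \<open>auto simp: u_def Basis_vec_def inner_axis\<close>)
  moreover have "0 < (\<Prod>b\<in>Basis. (u - 0) \<bullet> b)"
    by (rule prod_pos) (use s0 in \<open>auto simp: u_def Basis_vec_def inner_axis\<close>)
  ultimately show False by (metis ennreal_eq_0_iff not_le)
qed

end

subsection \<open>Archimedean copulas\<close>

text \<open>Weak monotonicity is drawn directly from the representation because it enters the proof
  of surjectivity, on which the strict version \<open>psi_strict\<close> rests.\<close>

lemma cm_generator_antimono:
  assumes "cm_generator \<psi>" "0 < u" "u \<le> v"
  shows "\<psi> v \<le> \<psi> u"
proof -
  obtain \<mu> where \<mu>: "sets \<mu> = sets (restrict_space borel {0..})"
    "\<And>u. 0 < u \<Longrightarrow> has_bochner_integral \<mu> (\<lambda>x. exp (- u * x)) (\<psi> u)"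
    using assms(1) unfolding cm_generator_def by blast
  have "space \<mu> = {0..}"
    using sets_eq_imp_space_eq[OF \<mu>(1)] by (simp add: space_restrict_space)
  then have "(\<integral>x. exp (- v * x) \<partial>\<mu>) \<le> (\<integral>x. exp (- u * x) \<partial>\<mu>)"
    using \<mu>(2)[of u] \<mu>(2)[of v] assms(2,3)
    by (intro integral_mono) (auto simp: has_bochner_integral_iff intro: mult_right_mono)
  then show ?thesis
    using \<mu>(2)[of u] \<mu>(2)[of v] assms(2,3) by (simp add: has_bochner_integral_iff)
qed

text \<open>The measure is pushed forward to the real line. Its mass at 0 is at most
  \<open>\<psi> u\<close> for every positive \<open>u\<close>, and by surjectivity these values come
  arbitrarily close to 0.\<close>

lemma cm_generator_laplace_transform:
  assumes cm: "cm_generator \<psi>" and surj: "{0<..<1} \<subseteq> \<psi> ` {0<..}"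
  shows "\<exists>\<nu>. laplace_transform \<nu> \<psi>"
proof -
  have range: "\<psi> u \<in> {0<..<1}" if "0 < u" for u
    using cm that by (auto simp: cm_generator_def)
  obtain \<mu> where sets: "sets \<mu> = sets (restrict_space borel {0..})"
    and int: "\<And>u. 0 < u \<Longrightarrow> has_bochner_integral \<mu> (\<lambda>x. exp (- u * x)) (\<psi> u)"
    using cm unfolding cm_generator_def by blast
  have space: "space \<mu> = {0..}"
    using sets_eq_imp_space_eq[OF sets] by (simp add: space_restrict_space)
  have id [measurable]: "(\<lambda>x. x) \<in> borel_measurable \<mu>"
    by (subst measurable_cong_sets[OF sets refl]) (rule measurable_restrict_space1, simp)
  define \<nu> where "\<nu> = distr \<mu> borel (\<lambda>x. x)"
  have transform: "has_bochner_integral \<nu> (\<lambda>x. exp (- u * x)) (\<psi> u)" if "0 < u" for u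
    unfolding \<nu>_def using int[OF that]
    by (subst has_bochner_integral_distr) auto
  have "emeasure \<nu> {0} \<le> ennreal \<epsilon>" if \<epsilon>: "0 < \<epsilon>" for \<epsilon>
  proof -
    \<comment> \<open>The cap \<open>1 / 2\<close> keeps the prescribed value inside the open unit
      interval.\<close>
    obtain u where u: "0 < u" "\<psi> u = min \<epsilon> (1 / 2)"
      using subsetD[OF surj, of "min \<epsilon> (1 / 2)"] \<epsilon> by (auto simp: min_less_iff_disj)
    have "emeasure \<nu> {0} = (\<integral>\<^sup>+x. indicator {0} x \<partial>\<nu>)" by (simp add: \<nu>_def)
    also have "\<dots> \<le> (\<integral>\<^sup>+x. ennreal (exp (- u * x)) \<partial>\<nu>)"
      by (intro nn_integral_mono) (auto simp: indicator_def)
    also have "\<dots> = ennreal (\<psi> u)"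
      using transform[OF u(1)] by (subst nn_integral_eq_integral) (auto simp: has_bochner_integral_iff)
    also have "\<dots> \<le> ennreal \<epsilon>" using u by (simp add: ennreal_leI)
    finally show ?thesis .
  qed
  then have "emeasure \<nu> {0} = 0"
    by (metis add.left_neutral ennreal_le_epsilon le_zero_eq)
  then have "AE x in \<nu>. x \<noteq> 0"
    by (intro AE_I[of _ _ "{0}"]) (auto simp: \<nu>_def)
  moreover have "AE x in \<nu>. 0 \<le> x"
    unfolding \<nu>_def by (subst AE_distr_iff) (auto simp: space intro!: AE_I2)
  ultimately have "AE x in \<nu>. 0 < x" by eventually_elim auto
  then have "laplace_transform \<nu> \<psi>"
    using transform range[of 1] by unfold_locales (auto simp: \<nu>_def)
  then show ?thesis by blast
qed

text \<open>The predicate under the choice operator is unsatisfiable, so one default value serves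
  every unattained point.\<close>

lemma inv_into_unattained: "p \<notin> f ` A \<Longrightarrow> inv_into A f p = (SOME x. False)"
  unfolding inv_into_def by (rule arg_cong[where f=Eps]) auto

section \<open>Regularity of the generator of an Archimedean copula\<close>

locale archimedean_vector = prob_space M
  for M :: "'a measure" +
  fixes Y :: "'a \<Rightarrow> real" and X :: "'a \<Rightarrow> real ^ 'd" and \<psi> :: "real \<Rightarrow> real"
  assumes Y [measurable]: "Y \<in> borel_measurable M" and X [measurable]: "X \<in> borel_measurable M"
    and cont_Y: "continuous_on UNIV (cdf (distr M borel Y))"
    and cont_X: "\<And>i. continuous_on UNIV (cdf (distr M borel (\<lambda>\<omega>. X \<omega> $ i)))"
    and cm: "cm_generator \<psi>"
    and copula: "\<And>y x. y \<in> {0<..<1} \<Longrightarrow> (\<And>i. x $ i \<in> {0<..<1}) \<Longrightarrow>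
           copula M Y X y x = arch_copula \<psi> y x"
begin

definition "FY = cdf (distr M borel Y)"
definition "FX i = cdf (distr M borel (\<lambda>\<omega>. X \<omega> $ i))"
definition "T = inv_into {0<..} \<psi>"

lemma X_nth [measurable]: "(\<lambda>\<omega>. X \<omega> $ i) \<in> borel_measurable M"
  by (rule measurable_compose[OF X]) measurable

lemma FY_measurable [measurable]: "FY \<in> borel_measurable borel"
  unfolding FY_def by (rule borel_measurable_continuous_onI[OF cont_Y])

lemma FX_measurable [measurable]: "FX i \<in> borel_measurable borel"
  unfolding FX_def by (rule borel_measurable_continuous_onI[OF cont_X])

lemmas prob_FY_le = prob_cdf_le[OF Y cont_Y, folded FY_def]
lemmas AE_FY_unit = AE_cdf_in_unit[OF Y cont_Y, folded FY_def]
lemmas AE_le_iff_FY_le = AE_le_iff_cdf_le[OF Y cont_Y, folded FY_def]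
lemmas prob_FX_le = prob_cdf_le[OF X_nth cont_X, folded FX_def]
lemmas AE_FX_unit = AE_cdf_in_unit[OF X_nth cont_X, folded FX_def]
lemmas AE_le_iff_FX_le = AE_le_iff_cdf_le[OF X_nth cont_X, folded FX_def]

lemma copula_eq: "copula M Y X y x = prob {\<omega> \<in> space M. FY (Y \<omega>) \<le> y \<and> (\<forall>i. FX i (X \<omega> $ i) \<le> x $ i)}"
  by (simp add: copula_def FY_def FX_def)

text \<open>As \<open>x\<close> tends to the all-ones vector the copula value tends to
  \<open>y\<close>, with an error controlled by the union bound. This recovers the margin from
  arguments in the open cube only.\<close>

lemma copula_margin:
  assumes y: "y \<in> {0<..<1}" and x: "\<And>i. x $ i \<in> {0<..<1}"
  shows "copula M Y X y x \<le> y" "y \<le> copula M Y X y x + (\<Sum>i\<in>UNIV. 1 - x $ i)"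
proof -
  let ?U = "{\<omega> \<in> space M. FY (Y \<omega>) \<le> y}"
  let ?C = "{\<omega> \<in> space M. FY (Y \<omega>) \<le> y \<and> (\<forall>i. FX i (X \<omega> $ i) \<le> x $ i)}"
  let ?V = "\<lambda>i. {\<omega> \<in> space M. \<not> FX i (X \<omega> $ i) \<le> x $ i}"
  have U: "prob ?U = y" using prob_FY_le[of y] y by simp
  have V: "prob (?V i) = 1 - x $ i" for i
    using prob_FX_le[of "x $ i" i] x[of i] by (subst prob_neg) auto
  have "prob ?C \<le> prob ?U" by (intro finite_measure_mono) auto
  then show "copula M Y X y x \<le> y" by (simp add: copula_eq U)
  have "prob ?U \<le> prob (?C \<union> (\<Union>i. ?V i))" by (intro finite_measure_mono) auto
  also have "\<dots> \<le> prob ?C + prob (\<Union>i. ?V i)"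
    by (intro measure_Un_le) auto
  also have "prob (\<Union>i. ?V i) \<le> (\<Sum>i\<in>UNIV. prob (?V i))"
    by (intro finite_measure_subadditive_finite) auto
  finally show "y \<le> copula M Y X y x + (\<Sum>i\<in>UNIV. 1 - x $ i)"
    by (simp add: copula_eq U V)
qed

text \<open>\<open>arch_copula\<close> sees \<open>y\<close> only through
  \<open>gen_inv \<psi> y\<close>. Equal inverses give equal copula values for all \<open>x\<close>,
  and \<open>copula_margin\<close> then identifies the margins.\<close>

lemma gen_inv_inj:
  assumes y: "y \<in> {0<..<1}" "y' \<in> {0<..<1}" and eq: "gen_inv \<psi> y = gen_inv \<psi> y'"
  shows "y = y'"
proof -
  have le: "y \<le> y'" if y: "y \<in> {0<..<1}" "y' \<in> {0<..<1}" and eq: "gen_inv \<psi> y = gen_inv \<psi> y'" for y y'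
  proof (rule field_le_epsilon)
    fix e :: real assume e: "0 < e"
    \<comment> \<open>The gaps to 1 add up to at most \<open>e\<close>, while the cap
      \<open>1 / 2\<close> keeps \<open>x\<close> in the open cube.\<close>
    define x :: "real ^ 'd" where "x = (\<chi> i. 1 - min (e / real CARD('d)) (1 / 2))"
    have "0 < min (e / real CARD('d)) (1 / 2)" "min (e / real CARD('d)) (1 / 2) < 1" using e by auto
    then have x: "x $ i \<in> {0<..<1}" for i by (simp add: x_def)
    have "y \<le> copula M Y X y x + (\<Sum>i\<in>UNIV. 1 - x $ i)" by (rule copula_margin(2)[OF y(1) x])
    also have "copula M Y X y x = copula M Y X y' x"
      using copula[OF y(1) x] copula[OF y(2) x] eq by (simp add: arch_copula_def)
    also have "\<dots> \<le> y'" by (rule copula_margin(1)[OF y(2) x])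
    also have "(\<Sum>i\<in>UNIV. 1 - x $ i) \<le> (\<Sum>i::'d\<in>UNIV. e / real CARD('d))"
      by (intro sum_mono) (auto simp: x_def)
    also have "\<dots> = e" by simp
    finally show "y \<le> y' + e" by simp
  qed
  show ?thesis using le[OF y eq] le[OF y(2,1) eq[symmetric]] by simp
qed

lemma psi_range: "0 < u \<Longrightarrow> \<psi> u \<in> {0<..<1}"
  using cm by (auto simp: cm_generator_def)

text \<open>
  Two unattained values would share the junk value of \<^const>\<open>inv_into\<close> and hence be equal by
  \<open>gen_inv_inj\<close>. A single unattained value would make the image of the monotone function
  \<open>\<psi>\<close> open but disconnected.
\<close>

lemma psi_surj: "\<psi> ` {0<..} = {0<..<1}"
proof (rule ccontr)
  assume "\<psi> ` {0<..} \<noteq> {0<..<1}"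
  with psi_range obtain p where p: "p \<in> {0<..<1}" "p \<notin> \<psi> ` {0<..}" by blast
  have uniq: "q = p" if q: "q \<in> {0<..<1}" "q \<notin> \<psi> ` {0<..}" for q
    using p q by (intro gen_inv_inj) (auto simp: gen_inv_def inv_into_unattained)
  \<comment> \<open>The sign is flipped because \<open>continuous_onI_mono\<close> expects a
    nondecreasing function with open image.\<close>
  have image: "(\<lambda>u. - \<psi> u) ` {0<..} = {-1<..<0} - {- p}"
  proof (intro set_eqI iffI)
    fix v assume "v \<in> {-1<..<0} - {- p}"
    then have "- v \<in> \<psi> ` {0<..}" using uniq[of "- v"] by fastforce
    then show "v \<in> (\<lambda>u. - \<psi> u) ` {0<..}" by force
  qed (use p psi_range in force)
  then have "open ((\<lambda>u. - \<psi> u) ` {0<..})" by (auto intro!: open_Diff)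
  then have "continuous_on {0<..} (\<lambda>u. - \<psi> u)"
    using cm_generator_antimono[OF cm] by (intro continuous_onI_mono) auto
  then have "connected ((\<lambda>u. - \<psi> u) ` {0<..})"
    by (rule connected_continuous_image) simp
  then have "connected ({-1<..<0} - {- p})" by (simp only: image)
  \<comment> \<open>Both end points belong to the image and lie on opposite sides of
    \<open>- p\<close>.\<close>
  then have "{- ((1 + p) / 2) .. - (p / 2)} \<subseteq> {-1<..<0} - {- p}"
    by (rule connected_contains_Icc) (use p in auto)
  moreover have "- p \<in> {- ((1 + p) / 2) .. - (p / 2)}" using p by auto
  ultimately show False by blast
qed

lemma psi_continuous: "continuous_on {0<..} \<psi>"
proof -
  have "(\<lambda>u. - \<psi> u) ` {0<..} = {-1<..<0}"
    using psi_surj by (auto simp: set_eq_iff image_iff) (metis minus_minus neg_less_iff_less minus_less_iff minus_zero)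
  then have "continuous_on {0<..} (\<lambda>u. - \<psi> u)"
    using cm_generator_antimono[OF cm] by (intro continuous_onI_mono) auto
  then have "continuous_on {0<..} (\<lambda>u. - (- \<psi> u))" by (rule continuous_on_minus)
  then show ?thesis by simp
qed

lemma T_pos: "t \<in> {0<..<1} \<Longrightarrow> 0 < T t"
  using inv_into_into[of t \<psi> "{0<..}"] psi_surj by (simp add: T_def)

lemma psi_T: "t \<in> {0<..<1} \<Longrightarrow> \<psi> (T t) = t"
  using f_inv_into_f[of t \<psi> "{0<..}"] psi_surj by (simp add: T_def)

lemma psi_strict: "0 < u \<Longrightarrow> u < v \<Longrightarrow> \<psi> v < \<psi> u"
  using cm_generator_laplace_transform[OF cm] psi_surj laplace_transform.psi_strict_antimono by blast

lemma le_T_iff: "t \<in> {0<..<1} \<Longrightarrow> 0 < u \<Longrightarrow> u \<le> T t \<longleftrightarrow> t \<le> \<psi> u"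
  using psi_strict[of u "T t"] psi_strict[of "T t" u] T_pos[of t] psi_T[of t]
  by (cases u "T t" rule: linorder_cases) auto

lemma T_psi: "0 < u \<Longrightarrow> T (\<psi> u) = u"
  using psi_T[of "\<psi> u"] psi_range[of u] T_pos[of "\<psi> u"] psi_strict[of u "T (\<psi> u)"] psi_strict[of "T (\<psi> u)" u]
  by (cases u "T (\<psi> u)" rule: linorder_cases) auto

lemma gen_inv_T: "t \<in> {0<..<1} \<Longrightarrow> gen_inv \<psi> t = ennreal (T t)"
  by (simp add: gen_inv_def T_def)

text \<open>\<open>T\<close> is known to be monotone only on the open unit interval; the indicator
  removes the default values of \<open>inv_into\<close> outside it.\<close>

lemma T_measurable [measurable]: "(\<lambda>t. indicator {0<..<1} t * T t) \<in> borel_measurable borel"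
proof -
  have "mono_on {0<..<1} (\<lambda>t. - T t)"
    using le_T_iff T_pos psi_T by (auto intro!: mono_onI)
  then have "(\<lambda>t. - T t) \<in> borel_measurable (restrict_space borel {0<..<1})"
    by (rule borel_measurable_mono_on_fnc)
  then have "(\<lambda>t. - (- T t)) \<in> borel_measurable (restrict_space borel {0<..<1})"
    by measurable
  then show ?thesis by (subst (asm) borel_measurable_restrict_space_iff) auto
qed

lemma gen_inv_measurable [measurable]: "gen_inv \<psi> \<in> borel_measurable borel"
proof -
  have "gen_inv \<psi> = (\<lambda>t. if t \<le> 0 then \<infinity> else if 1 \<le> t then 0 else ennreal (indicator {0<..<1} t * T t))"
    by (auto simp: gen_inv_def T_def)
  then show ?thesis by simp
qed

lemma gen_measurable [measurable]: "gen \<psi> \<in> borel_measurable borel"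
proof -
  have "(\<lambda>u. indicator {0<..} u *\<^sub>R \<psi> u) \<in> borel_measurable borel"
    using psi_continuous by (intro borel_measurable_continuous_on_indicator) auto
  note [measurable] = this
  have "gen \<psi> = (\<lambda>u. if u = 0 then 1 else if u = \<infinity> then 0
      else indicator {0<..} (enn2real u) *\<^sub>R \<psi> (enn2real u))"
    by (auto simp: gen_def fun_eq_iff enn2real_positive_iff less_top zero_less_iff_neq_zero)
  then show ?thesis by simp
qed

section \<open>The transformed vector \<open>E\<close> and its orthant probabilities\<close>

definition E :: "'a \<Rightarrow> real ^ 'd" where
  "E \<omega> = (\<chi> i. indicator {0<..<1} (FX i (X \<omega> $ i)) * T (FX i (X \<omega> $ i)))"

lemma E_measurable [measurable]: "E \<in> borel_measurable M"
proof -
  have "(\<lambda>\<omega>. indicator {0<..<1} (FX i (X \<omega> $ i)) * T (FX i (X \<omega> $ i))) \<in> borel_measurable M" for i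
    by (rule measurable_compose[OF _ T_measurable]) measurable
  then show ?thesis
    unfolding E_def by (subst borel_measurable_euclidean_space) (auto simp: Basis_vec_def inner_axis)
qed

text \<open>The indicator in \<open>E\<close> is there for measurability; almost surely no margin
  takes the value 0 or 1, and \<open>E\<close> is the vector of generator inverses.\<close>

lemma AE_E: "AE \<omega> in M. \<forall>i. FX i (X \<omega> $ i) \<in> {0<..<1} \<and> E \<omega> $ i = T (FX i (X \<omega> $ i)) \<and> 0 < E \<omega> $ i"
proof -
  have "AE \<omega> in M. \<forall>i. FX i (X \<omega> $ i) \<in> {0<..<1}"
    using AE_FX_unit unfolding AE_all_countable by blast
  then show ?thesis
    by eventually_elim (auto simp: E_def indicator_def T_pos)
qed

text \<open>\<open>T\<close> reverses the order, so \<open>a $ i \<le> E \<omega> $ i\<close>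
  becomes an upper bound \<open>\<psi> (a $ i)\<close> on the margin. The event is then a copula
  event, and \<open>T\<close> undoes \<open>\<psi>\<close> in the formula.\<close>

lemma prob_E_orthant_joint:
  assumes a: "\<And>i. 0 < a $ i" and c: "c \<in> {0<..<1}"
  shows "prob {\<omega> \<in> space M. FY (Y \<omega>) \<le> c \<and> (\<forall>i. a $ i \<le> E \<omega> $ i)} = \<psi> (T c + (\<Sum>i\<in>UNIV. a $ i))"
proof -
  define x where "x = (\<chi> i. \<psi> (a $ i))"
  have x: "x $ i \<in> {0<..<1}" for i using psi_range[OF a] by (simp add: x_def)
  have "prob {\<omega> \<in> space M. FY (Y \<omega>) \<le> c \<and> (\<forall>i. a $ i \<le> E \<omega> $ i)} = copula M Y X c x"
    unfolding copula_eq
  proof (rule measure_eq_AE)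
    show "AE \<omega> in M. (\<omega> \<in> {\<omega> \<in> space M. FY (Y \<omega>) \<le> c \<and> (\<forall>i. a $ i \<le> E \<omega> $ i)}) =
      (\<omega> \<in> {\<omega> \<in> space M. FY (Y \<omega>) \<le> c \<and> (\<forall>i. FX i (X \<omega> $ i) \<le> x $ i)})"
      using AE_E by eventually_elim (auto simp: x_def le_T_iff a)
  qed auto
  also have "\<dots> = gen \<psi> (ennreal (T c) + (\<Sum>i\<in>UNIV. ennreal (a $ i)))"
    using copula[OF c x] c x by (simp add: arch_copula_def gen_inv_T x_def T_psi a)
  also have "ennreal (T c) + (\<Sum>i\<in>UNIV. ennreal (a $ i)) = ennreal (T c + (\<Sum>i\<in>UNIV. a $ i))"
    using a T_pos[OF c] by (simp add: sum_ennreal less_imp_le sum_nonneg)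
  also have "gen \<psi> \<dots> = \<psi> (T c + (\<Sum>i\<in>UNIV. a $ i))"
  proof -
    have "0 < T c + (\<Sum>i\<in>UNIV. a $ i)" using a T_pos[OF c] by (intro add_pos_nonneg sum_nonneg) (auto intro: less_imp_le)
    then show ?thesis by (auto simp: gen_def)
  qed
  finally show ?thesis .
qed

text \<open>The copula formula is available for \<open>y < 1\<close> only, so the constraint on
  \<open>Y\<close> is removed in the limit: as \<open>c\<close> tends to 1, \<open>T c\<close> tends
  to 0 and \<open>\<psi>\<close> is continuous at \<open>s\<close>.\<close>

lemma prob_E_orthant:
  assumes a: "\<And>i. 0 < a $ i"
  shows "prob {\<omega> \<in> space M. \<forall>i. a $ i \<le> E \<omega> $ i} = \<psi> (\<Sum>i\<in>UNIV. a $ i)"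
proof -
  define s where "s = (\<Sum>i\<in>UNIV. a $ i)"
  have s: "0 < s" unfolding s_def using a by (intro sum_pos) auto
  let ?p = "prob {\<omega> \<in> space M. \<forall>i. a $ i \<le> E \<omega> $ i}"
  have "?p \<le> \<psi> s + e \<and> \<psi> s \<le> ?p + e" if e: "0 < e" for e
  proof -
    have "isCont \<psi> s"
      using psi_continuous s by (simp add: continuous_on_eq_continuous_at)
    then obtain d where d: "0 < d" "\<And>u. \<bar>u - s\<bar> < d \<Longrightarrow> \<bar>\<psi> u - \<psi> s\<bar> < e"
      using e unfolding continuous_at_real_range by (metis real_norm_def)
    \<comment> \<open>The two lower bounds on \<open>c\<close> give \<open>1 - c \<le> e\<close> and
      \<open>T c \<le> d / 2\<close> respectively.\<close>
    define c where "c = max (1 - min e 1 / 2) (\<psi> (d / 2))"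
    have c: "c \<in> {0<..<1}" "1 - c \<le> e" "\<psi> (d / 2) \<le> c"
      using e d psi_range[of "d / 2"] by (auto simp: c_def min_def max_def)
    have "T c \<le> d / 2"
      using le_T_iff[OF c(1), of "d / 2"] c d psi_strict[of "d / 2" "T c"] T_pos[OF c(1)] psi_T[OF c(1)] by linarith
    then have close: "\<bar>\<psi> (T c + s) - \<psi> s\<bar> < e"
      using d(1) T_pos[OF c(1)] by (intro d(2)) auto
    have le: "\<psi> (T c + s) \<le> \<psi> s"
      using T_pos[OF c(1)] s cm_generator_antimono[OF cm, of s "T c + s"] by auto
    let ?U = "{\<omega> \<in> space M. FY (Y \<omega>) \<le> c}"
    let ?C = "{\<omega> \<in> space M. FY (Y \<omega>) \<le> c \<and> (\<forall>i. a $ i \<le> E \<omega> $ i)}"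
    have C: "prob ?C = \<psi> (T c + s)"
      unfolding s_def by (rule prob_E_orthant_joint[OF a c(1)])
    have "prob ?C \<le> ?p" by (intro finite_measure_mono) auto
    moreover have "?p \<le> prob (?C \<union> {\<omega> \<in> space M. \<not> FY (Y \<omega>) \<le> c})"
      by (intro finite_measure_mono) auto
    moreover have "\<dots> \<le> prob ?C + prob {\<omega> \<in> space M. \<not> FY (Y \<omega>) \<le> c}"
      by (intro measure_Un_le) auto
    moreover have "prob {\<omega> \<in> space M. \<not> FY (Y \<omega>) \<le> c} = 1 - c"
      using prob_FY_le[of c] c by (subst prob_neg) auto
    ultimately show ?thesis using C c close le by linarith
  qed
  then have "?p \<le> \<psi> s" "\<psi> s \<le> ?p" by (auto intro: field_le_epsilon)
  then show ?thesis by (simp add: s_def)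
qed

text \<open>\<open>X\<close> need not be a function of \<open>E\<close>, since the margins can have
  flat pieces. Up to null sets each half-space event of \<open>X\<close> is still an event of
  \<open>E\<close>, and the sets with this property form a sigma-algebra.\<close>

lemma borel_X_eq_E:
  assumes "A \<in> sets borel"
  shows "\<exists>B\<in>sets borel. AE \<omega> in M. X \<omega> \<in> A \<longleftrightarrow> E \<omega> \<in> B"
proof -
  have "A \<in> sigma_sets UNIV ((\<lambda>(a, i). {x::real^'d. x \<bullet> i \<le> a}) ` (UNIV \<times> Basis))"
    using assms by (subst (asm) borel_eq_halfspace_le) simp
  then show ?thesis
  proof induction
    case (Basic A)
    then obtain a k where A: "A = {x. x $ k \<le> a}"
      by (auto simp: Basis_vec_def inner_axis)
    have X_iff: "AE \<omega> in M. X \<omega> \<in> A \<longleftrightarrow> FX k (X \<omega> $ k) \<le> FX k a"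
      using AE_le_iff_FX_le[of k a] by (simp add: A)
    \<comment> \<open>At the levels 0 and 1 \<open>T\<close> gives no usable threshold; the event is
      then almost surely impossible or certain.\<close>
    consider "FX k a \<le> 0" | "1 \<le> FX k a" | "FX k a \<in> {0<..<1}" by fastforce
    then show ?case
    proof cases
      case 1
      have "AE \<omega> in M. X \<omega> \<in> A \<longleftrightarrow> E \<omega> \<in> {}"
        using X_iff AE_E
      proof eventually_elim
        case (elim \<omega>)
        then have "0 < FX k (X \<omega> $ k)" by simp
        with 1 elim show ?case by simp
      qed
      then show ?thesis by (rule bexI) simp
    next
      case 2
      have "AE \<omega> in M. X \<omega> \<in> A \<longleftrightarrow> E \<omega> \<in> UNIV"
        using X_iff AE_E
      proof eventually_elim
        case (elim \<omega>)
        then have "FX k (X \<omega> $ k) < 1" by simp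
        with 2 elim show ?case by simp
      qed
      then show ?thesis by (rule bexI) simp
    next
      case 3
      have "AE \<omega> in M. X \<omega> \<in> A \<longleftrightarrow> E \<omega> \<in> {e. T (FX k a) \<le> e $ k}"
        using X_iff AE_E
      proof eventually_elim
        case (elim \<omega>)
        then show ?case using le_T_iff[of "FX k (X \<omega> $ k)" "T (FX k a)"] T_pos[OF 3] psi_T[OF 3] by simp
      qed
      then show ?thesis by (rule bexI) measurable
    qed
  next
    case Empty
    then show ?case by (intro bexI[of _ "{}"]) auto
  next
    case (Compl A)
    then obtain B where "B \<in> sets borel" "AE \<omega> in M. X \<omega> \<in> A \<longleftrightarrow> E \<omega> \<in> B" by blast
    then show ?case by (intro bexI[of _ "- B"]) auto
  next
    case (Union A)
    then have "\<forall>n. \<exists>B. B \<in> sets borel \<and> (AE \<omega> in M. X \<omega> \<in> A n \<longleftrightarrow> E \<omega> \<in> B)"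
      by (simp add: Bex_def)
    from choice[OF this] obtain B where
      B: "\<forall>n. B n \<in> sets borel \<and> (AE \<omega> in M. X \<omega> \<in> A n \<longleftrightarrow> E \<omega> \<in> B n)" by (rule exE)
    then have "AE \<omega> in M. \<forall>n. X \<omega> \<in> A n \<longleftrightarrow> E \<omega> \<in> B n"
      by (simp add: AE_all_countable)
    then have "AE \<omega> in M. X \<omega> \<in> (\<Union>n. A n) \<longleftrightarrow> E \<omega> \<in> (\<Union>n. B n)"
      by eventually_elim auto
    with B show ?case by (intro bexI[of _ "\<Union>n. B n"]) auto
  qed
qed

section \<open>The score expressed through \<open>E\<close>\<close>

lemma arch_score_measurable [measurable]: "arch_score M X \<psi> \<in> borel_measurable borel"
proof -
  have "(\<lambda>x::real^'d. gen \<psi> (\<Sum>i\<in>UNIV. gen_inv \<psi> (FX i (x $ i)))) \<in> borel_measurable borel"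
    by measurable
  then show ?thesis by (simp add: arch_score_def[abs_def] FX_def)
qed

text \<open>Almost surely all inverses are finite and positive, so the boundary conventions of
  \<open>gen\<close> do not intervene and strict monotonicity of \<open>\<psi>\<close> translates
  the threshold.\<close>

lemma AE_arch_score:
  assumes \<tau>: "\<tau> \<in> {0<..<1}"
  shows "AE \<omega> in M. \<tau> < arch_score M X \<psi> (X \<omega>) \<longleftrightarrow> (\<Sum>i\<in>UNIV. E \<omega> $ i) < T \<tau>"
  using AE_E
proof eventually_elim
  case (elim \<omega>)
  have e: "0 < E \<omega> $ i" "gen_inv \<psi> (FX i (X \<omega> $ i)) = ennreal (E \<omega> $ i)" for i
    using spec[OF elim, of i] gen_inv_T[of "FX i (X \<omega> $ i)"] by auto
  have pos: "0 < (\<Sum>i\<in>UNIV. E \<omega> $ i)" using e by (intro sum_pos) auto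
  have "arch_score M X \<psi> (X \<omega>) = gen \<psi> (\<Sum>i\<in>UNIV. ennreal (E \<omega> $ i))"
    by (simp add: arch_score_def FX_def[symmetric] e)
  also have "(\<Sum>i\<in>UNIV. ennreal (E \<omega> $ i)) = ennreal (\<Sum>i\<in>UNIV. E \<omega> $ i)"
    using e by (intro sum_ennreal) (auto intro: less_imp_le)
  also have "gen \<psi> \<dots> = \<psi> (\<Sum>i\<in>UNIV. E \<omega> $ i)" using pos by (auto simp: gen_def)
  finally show ?case
    using le_T_iff[OF \<tau> T_pos[OF \<tau>]] pos T_pos[OF \<tau>] psi_T[OF \<tau>]
      psi_strict[of "\<Sum>i\<in>UNIV. E \<omega> $ i" "T \<tau>"] cm_generator_antimono[OF cm, of "T \<tau>" "\<Sum>i\<in>UNIV. E \<omega> $ i"]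
    by (cases "(\<Sum>i\<in>UNIV. E \<omega> $ i) < T \<tau>") auto
qed

section \<open>Laws of \<open>E\<close> and optimality\<close>

lemma distr_E:
  assumes "laplace_transform \<nu> \<psi>"
  shows "distr M borel E = laplace_transform.law \<nu> 0"
proof -
  interpret laplace_transform \<nu> \<psi> by fact
  show ?thesis
  proof (rule measure_eqI_pos_orthant)
    show "finite_measure (distr M borel E)" by (rule finite_measure_distr) simp
    show "AE x in distr M borel E. \<forall>i. 0 < x $ i"
      using AE_E by (subst AE_distr_iff) auto
    show "emeasure (distr M borel E) {x. \<forall>i. a $ i \<le> x $ i} =
        emeasure (law 0) {x. \<forall>i. a $ i \<le> x $ i}" if a: "\<And>i. 0 < a $ i" for a
    proof -
      have "emeasure (distr M borel E) {x. \<forall>i. a $ i \<le> x $ i} =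
          emeasure M {\<omega> \<in> space M. \<forall>i. a $ i \<le> E \<omega> $ i}"
        by (subst emeasure_distr) (auto intro!: arg_cong[where f="emeasure M"])
      then show ?thesis
        by (simp add: emeasure_eq_measure prob_E_orthant[OF a] emeasure_law_orthant[OF a])
    qed
  qed (simp_all add: AE_law_pos)
qed

lemma emeasure_E_joint:
  assumes "laplace_transform \<nu> \<psi>" and c: "c \<in> {0<..<1}" and A: "A \<in> sets borel"
  shows "emeasure M {\<omega> \<in> space M. FY (Y \<omega>) \<le> c \<and> E \<omega> \<in> A} =
    emeasure (laplace_transform.law \<nu> (T c)) A"
proof -
  interpret laplace_transform \<nu> \<psi> by fact
  define U where "U = {\<omega> \<in> space M. FY (Y \<omega>) \<le> c}"
  have U [measurable]: "U \<in> sets M" unfolding U_def by measurable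
  \<comment> \<open>Restricting to \<open>U\<close> without normalising gives a finite measure whose
    orthant masses are the joint probabilities themselves.\<close>
  define N where "N = distr (density M (indicator U)) borel E"
  have E' [measurable]: "E \<in> measurable (density M (indicator U)) borel"
    by simp
  have emeasure_N: "emeasure N B = emeasure M {\<omega> \<in> space M. FY (Y \<omega>) \<le> c \<and> E \<omega> \<in> B}"
    if [measurable]: "B \<in> sets borel" for B
  proof -
    have "emeasure N B = emeasure (density M (indicator U)) (E -` B \<inter> space M)"
      unfolding N_def by (subst emeasure_distr) auto
    also have "\<dots> = (\<integral>\<^sup>+\<omega>. indicator U \<omega> * indicator (E -` B \<inter> space M) \<omega> \<partial>M)"
      by (rule emeasure_density) auto
    also have "\<dots> = (\<integral>\<^sup>+\<omega>. indicator (U \<inter> (E -` B \<inter> space M)) \<omega> \<partial>M)"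
      by (simp add: indicator_inter_arith)
    also have "\<dots> = emeasure M (U \<inter> (E -` B \<inter> space M))"
      by (rule nn_integral_indicator) measurable
    also have "U \<inter> (E -` B \<inter> space M) = {\<omega> \<in> space M. FY (Y \<omega>) \<le> c \<and> E \<omega> \<in> B}"
      by (auto simp: U_def)
    finally show ?thesis .
  qed
  have "N = law (T c)"
  proof (rule measure_eqI_pos_orthant)
    show "finite_measure N"
    proof
      have "emeasure N UNIV \<noteq> \<infinity>" by (subst emeasure_N) auto
      then show "emeasure N (space N) \<noteq> \<infinity>" by (simp add: N_def)
    qed
    show "sets N = sets borel" by (simp add: N_def)
    show "AE x in N. \<forall>i. 0 < x $ i"
      unfolding N_def using AE_E by (subst AE_distr_iff, simp, simp, subst AE_density) auto
    show "emeasure N {x. \<forall>i. a $ i \<le> x $ i} = emeasure (law (T c)) {x. \<forall>i. a $ i \<le> x $ i}"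
      if a: "\<And>i. 0 < a $ i" for a
      using T_pos[OF c]
      by (subst emeasure_N)
         (simp_all add: emeasure_eq_measure prob_E_orthant_joint[OF a c] emeasure_law_orthant[OF a])
  qed (simp_all add: AE_law_pos)
  then show ?thesis using emeasure_N[OF A] by simp
qed

lemma prob_joint_sublevel_le:
  assumes A [measurable]: "A \<in> sets borel" and s0: "0 < s0"
    and eq: "prob {\<omega> \<in> space M. E \<omega> \<in> A} = prob {\<omega> \<in> space M. (\<Sum>i\<in>UNIV. E \<omega> $ i) < s0}"
  shows "prob {\<omega> \<in> space M. Y \<omega> \<le> y0 \<and> (\<Sum>i\<in>UNIV. E \<omega> $ i) < s0} \<le>
    prob {\<omega> \<in> space M. Y \<omega> \<le> y0 \<and> E \<omega> \<in> A}"
proof -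
  obtain \<nu> where "laplace_transform \<nu> \<psi>"
    using cm_generator_laplace_transform[OF cm] psi_surj by blast
  then interpret laplace_transform \<nu> \<psi> .
  note \<nu> = \<open>laplace_transform \<nu> \<psi>\<close>
  define B where "B = {e::real^'d. (\<Sum>i\<in>UNIV. e $ i) < s0}"
  have B [measurable]: "B \<in> sets borel" unfolding B_def by measurable
  define c where "c = FY y0"
  have Y_iff: "prob {\<omega> \<in> space M. Y \<omega> \<le> y0 \<and> E \<omega> \<in> S} = prob {\<omega> \<in> space M. FY (Y \<omega>) \<le> c \<and> E \<omega> \<in> S}"
    if [measurable]: "S \<in> sets borel" for S
    using AE_le_iff_FY_le[of y0] unfolding c_def by (intro measure_eq_AE) auto
  have eq: "prob {\<omega> \<in> space M. E \<omega> \<in> A} = prob {\<omega> \<in> space M. E \<omega> \<in> B}"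
    using eq by (simp add: B_def)
  have "prob {\<omega> \<in> space M. FY (Y \<omega>) \<le> c \<and> E \<omega> \<in> B} \<le> prob {\<omega> \<in> space M. FY (Y \<omega>) \<le> c \<and> E \<omega> \<in> A}"
  proof -
    \<comment> \<open>\<open>T c\<close> is meaningful only for \<open>c\<close> strictly between 0
      and 1. Otherwise the condition on \<open>Y\<close> almost surely fails or almost surely holds,
      and the claim is immediate.\<close>
    consider "c \<le> 0" | "1 \<le> c" | "c \<in> {0<..<1}" by fastforce
    then show ?thesis
    proof cases
      case 1
      have "prob {\<omega> \<in> space M. FY (Y \<omega>) \<le> c \<and> E \<omega> \<in> B} = prob {}"
        using AE_FY_unit 1 by (intro measure_eq_AE) auto
      then show ?thesis by simp
    next
      case 2
      have "prob {\<omega> \<in> space M. FY (Y \<omega>) \<le> c \<and> E \<omega> \<in> S} = prob {\<omega> \<in> space M. E \<omega> \<in> S}"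
        if [measurable]: "S \<in> sets borel" for S
        using AE_FY_unit 2 by (intro measure_eq_AE) auto
      then show ?thesis using eq by simp
    next
      case 3
      have law0: "emeasure (law 0) S = ennreal (prob {\<omega> \<in> space M. E \<omega> \<in> S})"
        if [measurable]: "S \<in> sets borel" for S
        unfolding distr_E[OF \<nu>, symmetric] emeasure_eq_measure[symmetric]
        by (subst emeasure_distr) (auto intro!: arg_cong[where f="emeasure M"])
      have "emeasure (law (T c)) B \<le> emeasure (law (T c)) A"
        unfolding B_def
      proof (rule law_sublevel_minimal[OF A s0 T_pos[OF 3]])
        show "finite_measure (law 0 :: (real ^ 'd) measure)"
          unfolding distr_E[OF \<nu>, symmetric] by (rule finite_measure_distr) simp
        show "emeasure (law 0) A = emeasure (law 0) {e::real^'d. (\<Sum>i\<in>UNIV. e $ i) < s0}"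
          unfolding B_def[symmetric] by (simp add: law0 eq)
      qed
      then show ?thesis
        by (simp add: emeasure_E_joint[OF \<nu> 3, symmetric] emeasure_eq_measure)
    qed
  qed
  then show ?thesis using Y_iff[OF A] Y_iff[OF B] by (simp add: B_def)
qed

lemma prob_sublevel:
  assumes s0: "0 < s0"
  shows "prob {\<omega> \<in> space M. (\<Sum>i\<in>UNIV. E \<omega> $ i) < s0} \<in> {0<..<1}"
proof -
  obtain \<nu> where "laplace_transform \<nu> \<psi>"
    using cm_generator_laplace_transform[OF cm] psi_surj by blast
  then interpret laplace_transform \<nu> \<psi> .
  note \<nu> = \<open>laplace_transform \<nu> \<psi>\<close>
  let ?B = "{\<omega> \<in> space M. (\<Sum>i\<in>UNIV. E \<omega> $ i) < s0}"
  have B [measurable]: "?B \<in> sets M" by measurable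
  have "emeasure (law 0) {e::real^'d. (\<Sum>i\<in>UNIV. e $ i) < s0} = emeasure M ?B"
    unfolding distr_E[OF \<nu>, symmetric]
    by (subst emeasure_distr) (auto intro!: arg_cong[where f="emeasure M"])
  then have "prob ?B \<noteq> 0"
    using emeasure_law_sublevel_pos[OF s0, where 'd='d] by (simp add: emeasure_eq_measure)
  then have "0 < prob ?B" using measure_nonneg[of M ?B] by linarith
  moreover have "prob ?B < 1"
  proof -
    \<comment> \<open>If every coordinate is at least \<open>s0\<close>, so is the sum; this orthant
      has positive probability and lies outside the sublevel set.\<close>
    define a :: "real^'d" where "a = (\<chi> i. s0)"
    have a: "0 < a $ i" for i using s0 by (simp add: a_def)
    have "0 < prob {\<omega> \<in> space M. \<forall>i. a $ i \<le> E \<omega> $ i}"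
      unfolding prob_E_orthant[OF a] using psi_range[of "\<Sum>i\<in>UNIV. a $ i"] s0 by (simp add: a_def)
    also have "\<dots> \<le> prob {\<omega> \<in> space M. \<not> (\<Sum>i\<in>UNIV. E \<omega> $ i) < s0}"
    proof (rule finite_measure_mono)
      show "{\<omega> \<in> space M. \<forall>i. a $ i \<le> E \<omega> $ i} \<subseteq> {\<omega> \<in> space M. \<not> (\<Sum>i\<in>UNIV. E \<omega> $ i) < s0}"
      proof safe
        fix \<omega> assume \<omega>: "\<forall>i. a $ i \<le> E \<omega> $ i" "(\<Sum>i\<in>UNIV. E \<omega> $ i) < s0"
        have "s0 * 1 \<le> s0 * real CARD('d)" using s0 by (intro mult_left_mono) auto
        also have "s0 * real CARD('d) = (\<Sum>i\<in>UNIV. a $ i)" by (simp add: a_def)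
        also have "\<dots> \<le> (\<Sum>i\<in>UNIV. E \<omega> $ i)" using \<omega> by (intro sum_mono) auto
        finally show False using \<omega> by simp
      qed
    qed measurable
    also have "\<dots> = 1 - prob ?B" by (rule prob_neg) measurable
    finally show ?thesis by simp
  qed
  ultimately show ?thesis by simp
qed

lemma optimal_predictor_arch_score:
  assumes \<tau>: "\<tau> \<in> {0<..<1}"
  shows "optimal_predictor M Y X y0 (arch_score M X \<psi>) \<tau>"
  unfolding optimal_predictor_def
\<comment> \<open>The calibration level is read off from the sublevel event of \<open>E\<close> that
  is almost surely the predictor.\<close>
proof (intro bexI[of _ "1 - prob {\<omega> \<in> space M. (\<Sum>i\<in>UNIV. E \<omega> $ i) < T \<tau>}"] conjI allI impI)
  let ?B = "{\<omega> \<in> space M. (\<Sum>i\<in>UNIV. E \<omega> $ i) < T \<tau>}"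
  let ?h = "arch_score M X \<psi>"
  have hX [measurable]: "(\<lambda>\<omega>. ?h (X \<omega>)) \<in> borel_measurable M" by measurable
  show "1 - prob ?B \<in> {0<..<1}" using prob_sublevel[OF T_pos[OF \<tau>]] by simp
  have h: "prob {\<omega> \<in> space M. \<tau> < ?h (X \<omega>)} = prob ?B"
    using AE_arch_score[OF \<tau>] by (intro measure_eq_AE) auto
  then show "calibrated M X (1 - prob ?B) ?h \<tau>" by (simp add: calibrated_def)
  fix g g0 assume g: "calibrated M X (1 - prob ?B) g g0"
  then have [measurable]: "g \<in> borel_measurable borel"
    and gB: "prob {\<omega> \<in> space M. g0 < g (X \<omega>)} = prob ?B" by (auto simp: calibrated_def)
  \<comment> \<open>The competitor is an arbitrary Borel event in \<open>X\<close>; it is rewritten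
    as an event in \<open>E\<close>, where the minimality result applies.\<close>
  have "{x. g0 < g x} \<in> sets borel" by measurable
  from borel_X_eq_E[OF this] obtain A where A [measurable]: "A \<in> sets borel"
    and AE_A: "AE \<omega> in M. g0 < g (X \<omega>) \<longleftrightarrow> E \<omega> \<in> A" by auto
  have "prob {\<omega> \<in> space M. E \<omega> \<in> A} = prob {\<omega> \<in> space M. g0 < g (X \<omega>)}"
    using AE_A by (intro measure_eq_AE) auto
  then have "prob {\<omega> \<in> space M. Y \<omega> \<le> y0 \<and> (\<Sum>i\<in>UNIV. E \<omega> $ i) < T \<tau>} \<le>
      prob {\<omega> \<in> space M. Y \<omega> \<le> y0 \<and> E \<omega> \<in> A}"
    using gB by (intro prob_joint_sublevel_le T_pos \<tau>) auto
  moreover have "prob {\<omega> \<in> space M. Y \<omega> \<le> y0 \<and> (\<Sum>i\<in>UNIV. E \<omega> $ i) < T \<tau>} =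
      prob {\<omega> \<in> space M. Y \<omega> \<le> y0 \<and> \<tau> < ?h (X \<omega>)}"
    using AE_arch_score[OF \<tau>] by (intro measure_eq_AE) auto
  moreover have "prob {\<omega> \<in> space M. Y \<omega> \<le> y0 \<and> E \<omega> \<in> A} =
      prob {\<omega> \<in> space M. Y \<omega> \<le> y0 \<and> g0 < g (X \<omega>)}"
    using AE_A by (intro measure_eq_AE) auto
  \<comment> \<open>Both predictors have the same probability, so less mass on
    \<open>Y \<le> y0\<close> means more mass on \<open>y0 < Y\<close>, and the conditional
    probabilities share their denominator.\<close>
  moreover have "prob {\<omega> \<in> space M. k0 < k (X \<omega>)} =
      prob {\<omega> \<in> space M. y0 < Y \<omega> \<and> k0 < k (X \<omega>)} + prob {\<omega> \<in> space M. Y \<omega> \<le> y0 \<and> k0 < k (X \<omega>)}"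
    if [measurable]: "k \<in> borel_measurable borel" for k :: "real^'d \<Rightarrow> real" and k0
    by (subst finite_measure_Union[symmetric]) (auto intro!: arg_cong[where f=prob])
  from this[of ?h \<tau>] this[of g g0] have "prob {\<omega> \<in> space M. \<tau> < ?h (X \<omega>)} =
      prob {\<omega> \<in> space M. y0 < Y \<omega> \<and> \<tau> < ?h (X \<omega>)} + prob {\<omega> \<in> space M. Y \<omega> \<le> y0 \<and> \<tau> < ?h (X \<omega>)}"
    "prob {\<omega> \<in> space M. g0 < g (X \<omega>)} =
      prob {\<omega> \<in> space M. y0 < Y \<omega> \<and> g0 < g (X \<omega>)} + prob {\<omega> \<in> space M. Y \<omega> \<le> y0 \<and> g0 < g (X \<omega>)}"
    by simp_all
  ultimately have "prob {\<omega> \<in> space M. y0 < Y \<omega> \<and> g0 < g (X \<omega>)} \<le>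
      prob {\<omega> \<in> space M. y0 < Y \<omega> \<and> \<tau> < ?h (X \<omega>)}"
    using h gB by linarith
  then show "\<P>(\<omega> in M. y0 < Y \<omega> \<bar> g0 < g (X \<omega>)) \<le> \<P>(\<omega> in M. y0 < Y \<omega> \<bar> \<tau> < ?h (X \<omega>))"
    unfolding cond_prob_def h gB by (rule divide_right_mono) simp
qed

end

theorem proposition2p1:
  fixes M :: "'a measure" and Y :: "'a \<Rightarrow> real" and X :: "'a \<Rightarrow> real ^ 'd"
    and \<psi> :: "real \<Rightarrow> real" and \<tau> y0 :: real
  assumes "prob_space M"
    and "Y \<in> borel_measurable M" and "X \<in> borel_measurable M"
    and "continuous_on UNIV (cdf (distr M borel Y))"
    and "\<And>i. continuous_on UNIV (cdf (distr M borel (\<lambda>\<omega>. X \<omega> $ i)))"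
    and "cm_generator \<psi>"
    and "\<And>y x. y \<in> {0<..<1} \<Longrightarrow> (\<And>i. x $ i \<in> {0<..<1}) \<Longrightarrow>
           copula M Y X y x = arch_copula \<psi> y x"
    and "\<tau> \<in> {0<..<1}"
  shows "optimal_predictor M Y X y0 (arch_score M X \<psi>) \<tau>"
proof -
  interpret prob_space M by fact
  interpret archimedean_vector M Y X \<psi>
    by unfold_locales (fact assms)+
  show ?thesis using assms(8) by (rule optimal_predictor_arch_score)
qed

end
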